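(* Work over $\mathbb{Q}$. Each of the following five multihomogeneous identities of degree 10 is satisfied by the tetrad $\{a,b,c,d\}=abcd+dcba$ in every associative algebra but is not a consequence of the defining identities for Jordan quadruple systems. In each identity the sum is over all permutations $\sigma$ of the non-repeated variables (the variables other than $a$), $x^\sigma$ denotes the image of the variable $x$ under $\sigma$, and $\epsilon(\sigma)$ is the sign. (1) (variables $a^6bcde$) $\sum_{\sigma\in S_4}\epsilon(\sigma)\big( \{\{\{a,a,a,b^\sigma\},a,a,c^\sigma\},d^\sigma,a,e^\sigma\} -\{\{\{a,a,a,b^\sigma\},a,a,c^\sigma\},d^\sigma,e^\sigma,a\} +\{\{\{a,a,b^\sigma,a\},c^\sigma,a,a\},d^\sigma,e^\sigma,a\} +\{\{\{a,a,b^\sigma,a\},c^\sigma,a,d^\sigma\},a,e^\sigma,a\} +\{\{\{a,b^\sigma,a,c^\sigma\},a,d^\sigma,a\},a,a,e^\sigma\} -\{\{\{a,b^\sigma,a,c^\sigma\},a,d^\sigma,a\},a,e^\sigma,a\} -\{\{a,\{a,a,b^\sigma,a\},a,c^\sigma\},d^\sigma,a,e^\sigma\} -\{\{a,\{a,b^\sigma,a,c^\sigma\},a,d^\sigma\},a,e^\sigma,a\} +\{a,\{\{a,a,b^\sigma,a\},a,c^\sigma,d^\sigma\},a,e^\sigma\} -\{a,\{\{a,a,b^\sigma,c^\sigma\},d^\sigma,a,a\},a,e^\sigma\} +\{a,\{\{a,a,b^\sigma,c^\sigma\},d^\sigma,a,a\},e^\sigma,a\} +\{a,\{\{a,b^\sigma,a,c^\sigma\},a,d^\sigma,a\},e^\sigma,a\}\big)\equiv0$;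 (2) (variables $a^5bcdef$) $\sum_{\sigma\in S_5}\epsilon(\sigma)\big( \{\{\{a,a,b^\sigma,c^\sigma\},a,d^\sigma,a\},a,e^\sigma,f^\sigma\} -\{\{\{a,a,b^\sigma,c^\sigma\},a,d^\sigma,a\},e^\sigma,a,f^\sigma\} -\{\{\{a,a,b^\sigma,c^\sigma\},d^\sigma,a,a\},a,e^\sigma,f^\sigma\} +\{\{\{a,a,b^\sigma,c^\sigma\},d^\sigma,a,a\},e^\sigma,a,f^\sigma\} -\{\{\{a,b^\sigma,a,c^\sigma\},a,d^\sigma,a\},a,e^\sigma,f^\sigma\} +\{\{\{a,b^\sigma,a,c^\sigma\},a,d^\sigma,a\},e^\sigma,a,f^\sigma\} +\{\{\{a,b^\sigma,a,c^\sigma\},d^\sigma,a,a\},a,e^\sigma,f^\sigma\} -\{\{\{a,b^\sigma,a,c^\sigma\},d^\sigma,a,a\},e^\sigma,a,f^\sigma\} -\{\{\{b^\sigma,a,c^\sigma,d^\sigma\},a,e^\sigma,a\},a,f^\sigma,a\} -\{\{\{b^\sigma,a,c^\sigma,d^\sigma\},e^\sigma,a,a\},f^\sigma,a,a\} -\{\{\{b^\sigma,c^\sigma,a,d^\sigma\},a,e^\sigma,a\},f^\sigma,a,a\} -\{\{\{b^\sigma,c^\sigma,a,d^\sigma\},e^\sigma,a,a\},a,f^\sigma,a\}\big)\equiv0$; (3) (variables $a^5bcdef$) $\sum_{\sigma\in S_5}\epsilon(\sigma)\big( \{\{\{a,a,a,b^\sigma\},c^\sigma,d^\sigma,a\},e^\sigma,a,f^\sigma\}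 -\{\{\{a,a,a,b^\sigma\},c^\sigma,d^\sigma,a\},e^\sigma,f^\sigma,a\} +\{\{\{a,b^\sigma,a,c^\sigma\},d^\sigma,e^\sigma,a\},a,a,f^\sigma\} -\{\{\{a,b^\sigma,a,c^\sigma\},d^\sigma,e^\sigma,a\},a,f^\sigma,a\} -\{\{a,\{a,a,b^\sigma,c^\sigma\},a,d^\sigma\},e^\sigma,f^\sigma,a\} -\{\{a,\{a,a,b^\sigma,c^\sigma\},d^\sigma,a\},e^\sigma,a,f^\sigma\} +\{\{a,\{a,a,b^\sigma,c^\sigma\},d^\sigma,a\},e^\sigma,f^\sigma,a\} +\{\{a,\{a,b^\sigma,a,c^\sigma\},a,d^\sigma\},e^\sigma,f^\sigma,a\} -\{\{a,\{b^\sigma,a,c^\sigma,d^\sigma\},e^\sigma,a\},a,a,f^\sigma\} -\{\{a,\{b^\sigma,c^\sigma,a,d^\sigma\},e^\sigma,a\},a,f^\sigma,a\} +\{a,\{\{a,a,b^\sigma,c^\sigma\},a,d^\sigma,e^\sigma\},f^\sigma,a\} -\{a,\{\{a,b^\sigma,a,c^\sigma\},a,d^\sigma,e^\sigma\},f^\sigma,a\}\big)\equiv0$; (4) (variables $a^5bcdef$) $\sum_{\sigma\in S_5}\epsilon(\sigma)\big( \{\{\{a,a,b^\sigma,a\},c^\sigma,a,d^\sigma\},e^\sigma,f^\sigma,a\} -\{\{\{a,b^\sigma,a,c^\sigma\},a,a,d^\sigma\},e^\sigma,f^\sigma,a\} -\{\{\{a,b^\sigma,a,c^\sigma\},a,d^\sigma,a\},e^\sigma,f^\sigma,a\}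 +\{\{\{a,b^\sigma,a,c^\sigma\},d^\sigma,a,e^\sigma\},a,a,f^\sigma\} +\{\{\{a,b^\sigma,a,c^\sigma\},d^\sigma,e^\sigma,a\},a,a,f^\sigma\} +\{\{a,\{a,a,b^\sigma,c^\sigma\},d^\sigma,a\},e^\sigma,a,f^\sigma\} +\{\{a,\{a,b^\sigma,a,c^\sigma\},a,d^\sigma\},e^\sigma,a,f^\sigma\} +\{\{a,\{a,b^\sigma,a,c^\sigma\},d^\sigma,a\},e^\sigma,f^\sigma,a\} -\{\{a,\{b^\sigma,a,c^\sigma,d^\sigma\},a,e^\sigma\},a,a,f^\sigma\} -\{\{a,\{b^\sigma,c^\sigma,a,d^\sigma\},a,e^\sigma\},a,f^\sigma,a\} +\{\{b^\sigma,\{a,a,c^\sigma,a\},d^\sigma,a\},e^\sigma,a,f^\sigma\} -\{a,\{\{a,a,b^\sigma,c^\sigma\},d^\sigma,a,e^\sigma\},a,f^\sigma\} -\{a,\{\{a,b^\sigma,a,c^\sigma\},a,d^\sigma,e^\sigma\},a,f^\sigma\} -\{a,\{\{a,b^\sigma,a,c^\sigma\},a,d^\sigma,e^\sigma\},f^\sigma,a\} -\{a,\{\{a,b^\sigma,a,c^\sigma\},d^\sigma,a,e^\sigma\},f^\sigma,a\}\big)\equiv0$; (5) (variables $a^4bcdefg$) $\sum_{\sigma\in S_6}\epsilon(\sigma)\big( \{\{\{b^\sigma,a,c^\sigma,d^\sigma\},a,a,e^\sigma\},a,f^\sigma,g^\sigma\} -\{\{\{b^\sigma,a,c^\sigma,d^\sigma\},a,a,e^\sigma\},f^\sigma,a,g^\sigma\}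 +\{\{\{b^\sigma,a,c^\sigma,d^\sigma\},e^\sigma,a,f^\sigma\},a,a,g^\sigma\} -\{\{\{b^\sigma,c^\sigma,a,d^\sigma\},a,a,e^\sigma\},a,f^\sigma,g^\sigma\} +\{\{\{b^\sigma,c^\sigma,a,d^\sigma\},a,a,e^\sigma\},f^\sigma,a,g^\sigma\} +\{\{\{b^\sigma,c^\sigma,a,d^\sigma\},a,e^\sigma,f^\sigma\},a,a,g^\sigma\}\big)\equiv0$.
   Context: A Jordan quadruple system (JQS) over $\mathbb{Q}$ is a vector space $Q$ with a quadrilinear map $\{-,-,-,-\}\colon Q^4\to Q$ satisfying, for all values of the arguments, the following defining identities: the symmetry $\{a,b,c,d\}\equiv\{d,c,b,a\}$ and the three identities (i) $\{\{a,b,c,d\},e,f,g\}+\{\{a,b,f,e\},d,c,g\}+\{\{d,c,f,e\},a,b,g\}-\{g,\{b,a,d,c\},f,e\}-\{g,\{b,a,e,f\},c,d\}-\{g,\{c,d,e,f\},b,a\}\equiv 0$; (ii) $\{\{a,b,c,d\},e,f,g\}-\{\{a,b,g,f\},e,c,d\}+\{\{a,b,d,c\},e,g,f\}-\{\{a,b,f,g\},e,d,c\}+\{\{a,e,c,d\},b,g,f\}-\{\{a,e,g,f\},b,d,c\}+\{\{a,e,d,c\},b,f,g\}-\{\{a,e,f,g\},b,c,d\}-\{a,\{b,c,d,e\},f,g\}+\{a,\{b,g,f,e\},c,d\}-\{a,\{b,d,c,e\},g,f\}+\{a,\{b,f,g,e\},d,c\}\equiv 0$; (iii) $\{\{a,b,c,d\},e,f,g\}-\{\{a,f,g,c\},b,e,d\}+\{\{c,b,a,d\},e,g,f\}+\{\{f,b,c,e\},g,a,d\}-\{\{f,g,a,e\},c,b,d\}-\{\{f,g,a,d\},b,c,e\}-\{\{f,g,e,d\},a,b,c\}+\{\{g,b,a,e\},f,c,d\}-\{\{g,f,c,e\},a,b,d\}-\{\{g,f,c,d\},b,a,e\}-\{\{g,f,e,d\},c,b,a\}+\{\{e,a,b,d\},c,f,g\}+\{\{e,c,b,d\},a,g,f\}+\{a,\{b,c,g,f\},e,d\}+\{c,\{b,a,f,g\},e,d\}-\{f,\{b,c,e,g\},a,d\}-\{g,\{b,a,e,f\},c,d\}+\{e,\{a,g,f,c\},b,d\}\equiv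 0$. An identity is satisfied by the tetrad in every associative algebra if it holds whenever the operation is interpreted in an associative algebra as $\{x,y,z,w\}=xyzw+wzyx$. It is a consequence of the defining identities for JQS if it holds in every JQS. *)

theory Defs
  imports Complex_Main "HOL-Library.Poly_Mapping" "HOL-Library.Multiset" "HOL-Library.Countable_Set"
    "HOL-Combinatorics.Permutations"
begin

section \<open>Jordan quadruple systems and associative algebras over the rationals\<close>

locale jordan_quadruple_system = vector_space scale
  for scale :: "rat \<Rightarrow> 'q::ab_group_add \<Rightarrow> 'q" +
  fixes quad :: "'q \<Rightarrow> 'q \<Rightarrow> 'q \<Rightarrow> 'q \<Rightarrow> 'q"  ("\<lbrace>_, _, _, _\<rbrace>")
  assumes quad_linear1: "Vector_Spaces.linear scale scale (\<lambda>a. \<lbrace>a, b, c, d\<rbrace>)"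
    and quad_linear2: "Vector_Spaces.linear scale scale (\<lambda>b. \<lbrace>a, b, c, d\<rbrace>)"
    and quad_linear3: "Vector_Spaces.linear scale scale (\<lambda>c. \<lbrace>a, b, c, d\<rbrace>)"
    and quad_linear4: "Vector_Spaces.linear scale scale (\<lambda>d. \<lbrace>a, b, c, d\<rbrace>)"
    and quad_symmetric: "\<lbrace>a, b, c, d\<rbrace> = \<lbrace>d, c, b, a\<rbrace>"
    and quad_identity_i:
      "\<lbrace>\<lbrace>a, b, c, d\<rbrace>, e, f, g\<rbrace> + \<lbrace>\<lbrace>a, b, f, e\<rbrace>, d, c, g\<rbrace>
       + \<lbrace>\<lbrace>d, c, f, e\<rbrace>, a, b, g\<rbrace> - \<lbrace>g, \<lbrace>b, a, d, c\<rbrace>, f, e\<rbrace>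
       - \<lbrace>g, \<lbrace>b, a, e, f\<rbrace>, c, d\<rbrace> - \<lbrace>g, \<lbrace>c, d, e, f\<rbrace>, b, a\<rbrace> = 0"
    and quad_identity_ii:
      "\<lbrace>\<lbrace>a, b, c, d\<rbrace>, e, f, g\<rbrace> - \<lbrace>\<lbrace>a, b, g, f\<rbrace>, e, c, d\<rbrace>
       + \<lbrace>\<lbrace>a, b, d, c\<rbrace>, e, g, f\<rbrace> - \<lbrace>\<lbrace>a, b, f, g\<rbrace>, e, d, c\<rbrace>
       + \<lbrace>\<lbrace>a, e, c, d\<rbrace>, b, g, f\<rbrace> - \<lbrace>\<lbrace>a, e, g, f\<rbrace>, b, d, c\<rbrace>
       + \<lbrace>\<lbrace>a, e, d, c\<rbrace>, b, f, g\<rbrace> - \<lbrace>\<lbrace>a, e, f, g\<rbrace>, b, c, d\<rbrace>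
       - \<lbrace>a, \<lbrace>b, c, d, e\<rbrace>, f, g\<rbrace> + \<lbrace>a, \<lbrace>b, g, f, e\<rbrace>, c, d\<rbrace>
       - \<lbrace>a, \<lbrace>b, d, c, e\<rbrace>, g, f\<rbrace> + \<lbrace>a, \<lbrace>b, f, g, e\<rbrace>, d, c\<rbrace> = 0"
    and quad_identity_iii:
      "\<lbrace>\<lbrace>a, b, c, d\<rbrace>, e, f, g\<rbrace> - \<lbrace>\<lbrace>a, f, g, c\<rbrace>, b, e, d\<rbrace>
       + \<lbrace>\<lbrace>c, b, a, d\<rbrace>, e, g, f\<rbrace> + \<lbrace>\<lbrace>f, b, c, e\<rbrace>, g, a, d\<rbrace>
       - \<lbrace>\<lbrace>f, g, a, e\<rbrace>, c, b, d\<rbrace> - \<lbrace>\<lbrace>f, g, a, d\<rbrace>, b, c, e\<rbrace>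
       - \<lbrace>\<lbrace>f, g, e, d\<rbrace>, a, b, c\<rbrace> + \<lbrace>\<lbrace>g, b, a, e\<rbrace>, f, c, d\<rbrace>
       - \<lbrace>\<lbrace>g, f, c, e\<rbrace>, a, b, d\<rbrace> - \<lbrace>\<lbrace>g, f, c, d\<rbrace>, b, a, e\<rbrace>
       - \<lbrace>\<lbrace>g, f, e, d\<rbrace>, c, b, a\<rbrace> + \<lbrace>\<lbrace>e, a, b, d\<rbrace>, c, f, g\<rbrace>
       + \<lbrace>\<lbrace>e, c, b, d\<rbrace>, a, g, f\<rbrace> + \<lbrace>a, \<lbrace>b, c, g, f\<rbrace>, e, d\<rbrace>
       + \<lbrace>c, \<lbrace>b, a, f, g\<rbrace>, e, d\<rbrace> - \<lbrace>f, \<lbrace>b, c, e, g\<rbrace>, a, d\<rbrace>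
       - \<lbrace>g, \<lbrace>b, a, e, f\<rbrace>, c, d\<rbrace> + \<lbrace>e, \<lbrace>a, g, f, c\<rbrace>, b, d\<rbrace> = 0"

text \<open>Algebras are not assumed to be unital.\<close>

locale associative_algebra = vector_space scale
  for scale :: "rat \<Rightarrow> 'a::ring \<Rightarrow> 'a" +
  assumes scale_mult_left: "scale r x * y = scale r (x * y)"
    and scale_mult_right: "x * scale r y = scale r (x * y)"

definition tetrad :: "'a::ring \<Rightarrow> 'a \<Rightarrow> 'a \<Rightarrow> 'a \<Rightarrow> 'a" where
  "tetrad x y z w = x * y * z * w + w * z * y * x"


section \<open>Identities for a quadrilinear operation\<close>

text \<open>The nonassociative monomials span the free algebra with one quadrilinear operation; an
  identity is an element of this free algebra on the variables \<open>0, 1, 2, \<dots>\<close>.\<close>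

datatype 'x quad_monomial =
    Var 'x
  | Quad "'x quad_monomial" "'x quad_monomial" "'x quad_monomial" "'x quad_monomial"
      ("\<langle>_, _, _, _\<rangle>")

type_synonym quad_identity = "nat quad_monomial \<Rightarrow>\<^sub>0 rat"

primrec eval_monomial :: "('v \<Rightarrow> 'v \<Rightarrow> 'v \<Rightarrow> 'v \<Rightarrow> 'v) \<Rightarrow> ('x \<Rightarrow> 'v) \<Rightarrow> 'x quad_monomial \<Rightarrow> 'v"
  where
    "eval_monomial quad v (Var x) = v x"
  | "eval_monomial quad v \<langle>p, q, r, s\<rangle> =
      quad (eval_monomial quad v p) (eval_monomial quad v q)
           (eval_monomial quad v r) (eval_monomial quad v s)"

definition eval_identity ::
    "(rat \<Rightarrow> 'v::ab_group_add \<Rightarrow> 'v) \<Rightarrow> ('v \<Rightarrow> 'v \<Rightarrow> 'v \<Rightarrow> 'v \<Rightarrow> 'v) \<Rightarrow> (nat \<Rightarrow> 'v) \<Rightarrow> quad_identity \<Rightarrow> 'v"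
  where "eval_identity scale quad v I =
    (\<Sum>m\<in>Poly_Mapping.keys I. scale (Poly_Mapping.lookup I m) (eval_monomial quad v m))"

definition satisfied_by_tetrad :: "'a::ring itself \<Rightarrow> quad_identity \<Rightarrow> bool" where
  "satisfied_by_tetrad _ I \<longleftrightarrow>
    (\<forall>(scale :: rat \<Rightarrow> 'a \<Rightarrow> 'a) v.
      associative_algebra scale \<longrightarrow> eval_identity scale tetrad v I = 0)"

text \<open>A formula of HOL cannot quantify over all types, so the quantifier over all Jordan quadruple
  systems is restricted to those whose underlying space is the space \<open>nat \<Rightarrow>\<^sub>0 rat\<close> of countable
  dimension.  Theorem \<open>JQS_consequenceD\<close> below shows that this is no restriction: a consequence
  in this sense holds in every Jordan quadruple system, of any type.\<close>

definition JQS_consequence :: "quad_identity \<Rightarrow> bool" where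
  "JQS_consequence I \<longleftrightarrow>
    (\<forall>(scale :: rat \<Rightarrow> (nat \<Rightarrow>\<^sub>0 rat) \<Rightarrow> (nat \<Rightarrow>\<^sub>0 rat)) quad v.
      jordan_quadruple_system scale quad \<longrightarrow> eval_identity scale quad v I = 0)"


section \<open>The five identities\<close>

text \<open>\<open>alternating_sum n ts\<close> is the sum over all permutations \<open>\<sigma>\<close> of the variables \<open>1, \<dots>, n\<close> of
  \<open>\<epsilon>(\<sigma>)\<close> times the polynomial given by the list \<open>ts\<close> of coefficients and monomials, with every
  variable \<open>x\<close> replaced by \<open>\<sigma> x\<close>; the variable \<open>0\<close> is fixed.\<close>

definition alternating_sum :: "nat \<Rightarrow> (int \<times> nat quad_monomial) list \<Rightarrow> quad_identity" where
  "alternating_sum n ts =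
    (\<Sum>\<sigma> | \<sigma> permutes {1..n}. \<Sum>(k, m)\<leftarrow>ts.
      Poly_Mapping.single (map_quad_monomial \<sigma> m) (of_int (sign \<sigma> * k)))"

definition identity1 :: quad_identity where
  "identity1 = (let a = Var 0; b = Var 1; c = Var 2; d = Var 3; e = Var 4 in
    alternating_sum 4 [
      (1, \<langle>\<langle>\<langle>a, a, a, b\<rangle>, a, a, c\<rangle>, d, a, e\<rangle>),
      (-1, \<langle>\<langle>\<langle>a, a, a, b\<rangle>, a, a, c\<rangle>, d, e, a\<rangle>),
      (1, \<langle>\<langle>\<langle>a, a, b, a\<rangle>, c, a, a\<rangle>, d, e, a\<rangle>),
      (1, \<langle>\<langle>\<langle>a, a, b, a\<rangle>, c, a, d\<rangle>, a, e, a\<rangle>),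
      (1, \<langle>\<langle>\<langle>a, b, a, c\<rangle>, a, d, a\<rangle>, a, a, e\<rangle>),
      (-1, \<langle>\<langle>\<langle>a, b, a, c\<rangle>, a, d, a\<rangle>, a, e, a\<rangle>),
      (-1, \<langle>\<langle>a, \<langle>a, a, b, a\<rangle>, a, c\<rangle>, d, a, e\<rangle>),
      (-1, \<langle>\<langle>a, \<langle>a, b, a, c\<rangle>, a, d\<rangle>, a, e, a\<rangle>),
      (1, \<langle>a, \<langle>\<langle>a, a, b, a\<rangle>, a, c, d\<rangle>, a, e\<rangle>),
      (-1, \<langle>a, \<langle>\<langle>a, a, b, c\<rangle>, d, a, a\<rangle>, a, e\<rangle>),
      (1, \<langle>a, \<langle>\<langle>a, a, b, c\<rangle>, d, a, a\<rangle>, e, a\<rangle>),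
      (1, \<langle>a, \<langle>\<langle>a, b, a, c\<rangle>, a, d, a\<rangle>, e, a\<rangle>)])"

definition identity2 :: quad_identity where
  "identity2 = (let a = Var 0; b = Var 1; c = Var 2; d = Var 3; e = Var 4; f = Var 5 in
    alternating_sum 5 [
      (1, \<langle>\<langle>\<langle>a, a, b, c\<rangle>, a, d, a\<rangle>, a, e, f\<rangle>),
      (-1, \<langle>\<langle>\<langle>a, a, b, c\<rangle>, a, d, a\<rangle>, e, a, f\<rangle>),
      (-1, \<langle>\<langle>\<langle>a, a, b, c\<rangle>, d, a, a\<rangle>, a, e, f\<rangle>),
      (1, \<langle>\<langle>\<langle>a, a, b, c\<rangle>, d, a, a\<rangle>, e, a, f\<rangle>),
      (-1, \<langle>\<langle>\<langle>a, b, a, c\<rangle>, a, d, a\<rangle>, a, e, f\<rangle>),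
      (1, \<langle>\<langle>\<langle>a, b, a, c\<rangle>, a, d, a\<rangle>, e, a, f\<rangle>),
      (1, \<langle>\<langle>\<langle>a, b, a, c\<rangle>, d, a, a\<rangle>, a, e, f\<rangle>),
      (-1, \<langle>\<langle>\<langle>a, b, a, c\<rangle>, d, a, a\<rangle>, e, a, f\<rangle>),
      (-1, \<langle>\<langle>\<langle>b, a, c, d\<rangle>, a, e, a\<rangle>, a, f, a\<rangle>),
      (-1, \<langle>\<langle>\<langle>b, a, c, d\<rangle>, e, a, a\<rangle>, f, a, a\<rangle>),
      (-1, \<langle>\<langle>\<langle>b, c, a, d\<rangle>, a, e, a\<rangle>, f, a, a\<rangle>),
      (-1, \<langle>\<langle>\<langle>b, c, a, d\<rangle>, e, a, a\<rangle>, a, f, a\<rangle>)])"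

definition identity3 :: quad_identity where
  "identity3 = (let a = Var 0; b = Var 1; c = Var 2; d = Var 3; e = Var 4; f = Var 5 in
    alternating_sum 5 [
      (1, \<langle>\<langle>\<langle>a, a, a, b\<rangle>, c, d, a\<rangle>, e, a, f\<rangle>),
      (-1, \<langle>\<langle>\<langle>a, a, a, b\<rangle>, c, d, a\<rangle>, e, f, a\<rangle>),
      (1, \<langle>\<langle>\<langle>a, b, a, c\<rangle>, d, e, a\<rangle>, a, a, f\<rangle>),
      (-1, \<langle>\<langle>\<langle>a, b, a, c\<rangle>, d, e, a\<rangle>, a, f, a\<rangle>),
      (-1, \<langle>\<langle>a, \<langle>a, a, b, c\<rangle>, a, d\<rangle>, e, f, a\<rangle>),
      (-1, \<langle>\<langle>a, \<langle>a, a, b, c\<rangle>, d, a\<rangle>, e, a, f\<rangle>),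
      (1, \<langle>\<langle>a, \<langle>a, a, b, c\<rangle>, d, a\<rangle>, e, f, a\<rangle>),
      (1, \<langle>\<langle>a, \<langle>a, b, a, c\<rangle>, a, d\<rangle>, e, f, a\<rangle>),
      (-1, \<langle>\<langle>a, \<langle>b, a, c, d\<rangle>, e, a\<rangle>, a, a, f\<rangle>),
      (-1, \<langle>\<langle>a, \<langle>b, c, a, d\<rangle>, e, a\<rangle>, a, f, a\<rangle>),
      (1, \<langle>a, \<langle>\<langle>a, a, b, c\<rangle>, a, d, e\<rangle>, f, a\<rangle>),
      (-1, \<langle>a, \<langle>\<langle>a, b, a, c\<rangle>, a, d, e\<rangle>, f, a\<rangle>)])"

definition identity4 :: quad_identity where
  "identity4 = (let a = Var 0; b = Var 1; c = Var 2; d = Var 3; e = Var 4; f = Var 5 in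
    alternating_sum 5 [
      (1, \<langle>\<langle>\<langle>a, a, b, a\<rangle>, c, a, d\<rangle>, e, f, a\<rangle>),
      (-1, \<langle>\<langle>\<langle>a, b, a, c\<rangle>, a, a, d\<rangle>, e, f, a\<rangle>),
      (-1, \<langle>\<langle>\<langle>a, b, a, c\<rangle>, a, d, a\<rangle>, e, f, a\<rangle>),
      (1, \<langle>\<langle>\<langle>a, b, a, c\<rangle>, d, a, e\<rangle>, a, a, f\<rangle>),
      (1, \<langle>\<langle>\<langle>a, b, a, c\<rangle>, d, e, a\<rangle>, a, a, f\<rangle>),
      (1, \<langle>\<langle>a, \<langle>a, a, b, c\<rangle>, d, a\<rangle>, e, a, f\<rangle>),
      (1, \<langle>\<langle>a, \<langle>a, b, a, c\<rangle>, a, d\<rangle>, e, a, f\<rangle>),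
      (1, \<langle>\<langle>a, \<langle>a, b, a, c\<rangle>, d, a\<rangle>, e, f, a\<rangle>),
      (-1, \<langle>\<langle>a, \<langle>b, a, c, d\<rangle>, a, e\<rangle>, a, a, f\<rangle>),
      (-1, \<langle>\<langle>a, \<langle>b, c, a, d\<rangle>, a, e\<rangle>, a, f, a\<rangle>),
      (1, \<langle>\<langle>b, \<langle>a, a, c, a\<rangle>, d, a\<rangle>, e, a, f\<rangle>),
      (-1, \<langle>a, \<langle>\<langle>a, a, b, c\<rangle>, d, a, e\<rangle>, a, f\<rangle>),
      (-1, \<langle>a, \<langle>\<langle>a, b, a, c\<rangle>, a, d, e\<rangle>, a, f\<rangle>),
      (-1, \<langle>a, \<langle>\<langle>a, b, a, c\<rangle>, a, d, e\<rangle>, f, a\<rangle>),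
      (-1, \<langle>a, \<langle>\<langle>a, b, a, c\<rangle>, d, a, e\<rangle>, f, a\<rangle>)])"

definition identity5 :: quad_identity where
  "identity5 = (let a = Var 0; b = Var 1; c = Var 2; d = Var 3; e = Var 4; f = Var 5; g = Var 6 in
    alternating_sum 6 [
      (1, \<langle>\<langle>\<langle>b, a, c, d\<rangle>, a, a, e\<rangle>, a, f, g\<rangle>),
      (-1, \<langle>\<langle>\<langle>b, a, c, d\<rangle>, a, a, e\<rangle>, f, a, g\<rangle>),
      (1, \<langle>\<langle>\<langle>b, a, c, d\<rangle>, e, a, f\<rangle>, a, a, g\<rangle>),
      (-1, \<langle>\<langle>\<langle>b, c, a, d\<rangle>, a, a, e\<rangle>, a, f, g\<rangle>),
      (1, \<langle>\<langle>\<langle>b, c, a, d\<rangle>, a, a, e\<rangle>, f, a, g\<rangle>),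
      (1, \<langle>\<langle>\<langle>b, c, a, d\<rangle>, a, e, f\<rangle>, a, a, g\<rangle>)])"


section \<open>Adequacy\<close>

lemma (in jordan_quadruple_system) quad_span:
  assumes closed: "\<And>a b c d. a \<in> S \<Longrightarrow> b \<in> S \<Longrightarrow> c \<in> S \<Longrightarrow> d \<in> S \<Longrightarrow> quad a b c d \<in> span S"
    and "a \<in> span S" "b \<in> span S" "c \<in> span S" "d \<in> span S"
  shows "quad a b c d \<in> span S"
proof -
  have lin: "f x \<in> span S"
    if "Vector_Spaces.linear scale scale f" "x \<in> span S" "\<And>y. y \<in> S \<Longrightarrow> f y \<in> span S" for f x
  proof -
    interpret f: Vector_Spaces.linear scale scale f by fact
    have "f x \<in> f ` span S" using that(2) by simp
    also have "\<dots> = span (f ` S)" by (simp add: f.span_image)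
    also have "\<dots> \<subseteq> span S" using that(3) by (intro span_minimal) auto
    finally show ?thesis .
  qed
  have 1: "quad a b c d \<in> span S" if "a \<in> span S" "b \<in> S" "c \<in> S" "d \<in> S" for a b c d
    using lin[OF quad_linear1] that closed by blast
  have 2: "quad a b c d \<in> span S" if "a \<in> span S" "b \<in> span S" "c \<in> S" "d \<in> S" for a b c d
    using lin[OF quad_linear2] that 1 by blast
  have 3: "quad a b c d \<in> span S" if "a \<in> span S" "b \<in> span S" "c \<in> span S" "d \<in> S" for a b c d
    using lin[OF quad_linear3] that 2 by blast
  show ?thesis
    using lin[OF quad_linear4] assms(2-) 3 by blast
qed

definition pm_scale :: "rat \<Rightarrow> (nat \<Rightarrow>\<^sub>0 rat) \<Rightarrow> (nat \<Rightarrow>\<^sub>0 rat)" where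
  "pm_scale r p = Poly_Mapping.map ((*) r) p"

lemma lookup_pm_scale [simp]: "Poly_Mapping.lookup (pm_scale r p) n = r * Poly_Mapping.lookup p n"
  by (simp add: pm_scale_def Poly_Mapping.map.rep_eq when_def)

lemma vector_space_pm_scale: "vector_space pm_scale"
  by unfold_locales (auto intro!: poly_mapping_eqI simp: lookup_add algebra_simps)

text \<open>A space spanned by a countable set is a retract of \<open>nat \<Rightarrow>\<^sub>0 rat\<close>.\<close>

lemma (in vector_space) countable_span_retract:
  fixes S :: "'b set" and scale' :: "'a \<Rightarrow> (nat \<Rightarrow>\<^sub>0 'a) \<Rightarrow> (nat \<Rightarrow>\<^sub>0 'a)"
  assumes "countable S" and scale': "vector_space scale'"
    and lookup_scale': "\<And>r p n. Poly_Mapping.lookup (scale' r p) n = r * Poly_Mapping.lookup p n"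
  obtains \<phi> \<psi> where
    "Vector_Spaces.linear scale scale' \<phi>" "Vector_Spaces.linear scale' scale \<psi>"
    "range \<psi> \<subseteq> span S" "\<And>x. x \<in> span S \<Longrightarrow> \<psi> (\<phi> x) = x"
proof -
  interpret p: vector_space_pair scale scale'
    by (intro vector_space_pair.intro scale' vector_space_axioms)
  obtain B where B: "B \<subseteq> S" "independent B" "span B = span S"
    using maximal_independent_subset[of S] by (metis span_eq span_superset subset_trans)
  have "countable B" using B(1) assms(1) countable_subset by blast
  then obtain f :: "'b \<Rightarrow> nat" where f: "inj_on f B" unfolding countable_def by blast
  define g where "g n = (if n \<in> f ` B then inv_into B f n else 0)" for n
  have g: "g (f b) = b" if "b \<in> B" for b using that f by (simp add: g_def)
  have gB: "g n \<in> span B" for n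
    by (auto simp: g_def intro!: span_zero span_base f_inv_into_f inv_into_into)
  define \<psi> where "\<psi> p = (\<Sum>n\<in>Poly_Mapping.keys p. scale (Poly_Mapping.lookup p n) (g n))"
    for p :: "nat \<Rightarrow>\<^sub>0 'a"
  have \<psi>_alt: "\<psi> p = (\<Sum>n\<in>A. scale (Poly_Mapping.lookup p n) (g n))"
    if "finite A" "Poly_Mapping.keys p \<subseteq> A" for p A
    unfolding \<psi>_def using that by (intro sum.mono_neutral_left) (auto simp: in_keys_iff)
  have \<psi>_add: "\<psi> (p + q) = \<psi> p + \<psi> q" for p q
  proof -
    let ?A = "Poly_Mapping.keys p \<union> Poly_Mapping.keys q"
    show ?thesis
      by (subst (1 2 3) \<psi>_alt[where A = ?A])
         (use keys_add[of p q] in \<open>auto simp: lookup_add scale_left_distrib sum.distrib\<close>)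
  qed
  have \<psi>_scale: "\<psi> (scale' r p) = scale r (\<psi> p)" for r p
  proof -
    let ?A = "Poly_Mapping.keys p"
    have "Poly_Mapping.keys (scale' r p) \<subseteq> ?A"
      by (auto simp: in_keys_iff lookup_scale')
    then show ?thesis
      by (subst (1 2) \<psi>_alt[where A = ?A]) (auto simp: lookup_scale' scale_sum_right)
  qed
  have lin_\<psi>: "Vector_Spaces.linear scale' scale \<psi>"
    using \<psi>_add \<psi>_scale scale' vector_space_axioms
    by (simp add: Vector_Spaces.linear_def module_hom_def module_hom_axioms_def
        module_iff_vector_space)
  obtain \<phi> where \<phi>: "Vector_Spaces.linear scale scale' \<phi>"
      "\<And>b. b \<in> B \<Longrightarrow> \<phi> b = Poly_Mapping.single (f b) 1"
    using p.linear_independent_extend[OF B(2), of "\<lambda>b. Poly_Mapping.single (f b) 1"] by blast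
  have \<psi>\<phi>: "\<psi> (\<phi> x) = x" if "x \<in> span B" for x
  proof -
    have lin: "Vector_Spaces.linear scale scale (\<psi> \<circ> \<phi>)"
      by (rule Vector_Spaces.linear_compose[OF \<phi>(1) lin_\<psi>])
    interpret q: vector_space_pair scale scale by unfold_locales
    have "(\<psi> \<circ> \<phi>) x = id x"
    proof (rule q.linear_eq_on[OF lin _ that])
      show "Vector_Spaces.linear scale scale id" by (rule linear_id)
      show "(\<psi> \<circ> \<phi>) b = id b" if "b \<in> B" for b
        using that by (simp add: \<phi>(2) \<psi>_def g)
    qed
    then show ?thesis by simp
  qed
  show thesis
  proof (rule that[OF \<phi>(1) lin_\<psi>])
    show "range \<psi> \<subseteq> span S"
      unfolding B(3)[symmetric] using gB by (auto simp: \<psi>_def intro!: span_sum span_scale)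
    show "\<And>x. x \<in> span S \<Longrightarrow> \<psi> (\<phi> x) = x" using \<psi>\<phi> B(3) by simp
  qed
qed

theorem JQS_consequenceD:
  fixes scale :: "rat \<Rightarrow> 'q::ab_group_add \<Rightarrow> 'q"
  assumes "JQS_consequence I" and "jordan_quadruple_system scale quad"
  shows "eval_identity scale quad v I = 0"
proof -
  interpret Q: jordan_quadruple_system scale quad by fact
  define S where "S = range (eval_monomial quad v)"
  have "countable (UNIV :: nat quad_monomial set)"
  proof -
    have "\<exists>h :: nat quad_monomial \<Rightarrow> nat. inj h"
    proof -
      define h where "h = rec_quad_monomial (\<lambda>x. prod_encode (0, x))
        (\<lambda>_ _ _ _ p q r s. prod_encode (1, prod_encode (prod_encode (p, q), prod_encode (r, s))))"
      have "h m = h m' \<Longrightarrow> m = m'" for m m'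
      proof (induction m arbitrary: m')
        case (Var x)
        then show ?case by (cases m') (simp_all add: h_def)
      next
        case (Quad p q r s)
        then show ?case by (cases m') (simp_all add: h_def)
      qed
      then show ?thesis by (auto simp: inj_def)
    qed
    then show ?thesis by (auto simp: countable_def)
  qed
  then have "countable S" unfolding S_def by blast
  then obtain \<phi> \<psi> where lin: "Vector_Spaces.linear scale pm_scale \<phi>"
      "Vector_Spaces.linear pm_scale scale \<psi>"
    and \<psi>: "range \<psi> \<subseteq> Q.span S" "\<And>x. x \<in> Q.span S \<Longrightarrow> \<psi> (\<phi> x) = x"
    by (rule Q.countable_span_retract[OF _ vector_space_pm_scale]) auto
  interpret \<phi>: Vector_Spaces.linear scale pm_scale \<phi> by fact
  interpret \<psi>: Vector_Spaces.linear pm_scale scale \<psi> by fact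
  have mono_S: "eval_monomial quad v m \<in> Q.span S" for m
    by (auto simp: S_def intro: Q.span_base)
  have closed: "quad a b c d \<in> Q.span S"
    if "a \<in> Q.span S" "b \<in> Q.span S" "c \<in> Q.span S" "d \<in> Q.span S" for a b c d
  proof (rule Q.quad_span[OF _ that])
    fix a b c d assume "a \<in> S" "b \<in> S" "c \<in> S" "d \<in> S"
    then obtain p q r s where "a = eval_monomial quad v p" "b = eval_monomial quad v q"
      "c = eval_monomial quad v r" "d = eval_monomial quad v s" by (auto simp: S_def)
    then have "quad a b c d = eval_monomial quad v (Quad p q r s)" by simp
    then show "quad a b c d \<in> Q.span S" using mono_S by metis
  qed
  define quad' where "quad' a b c d = \<phi> (quad (\<psi> a) (\<psi> b) (\<psi> c) (\<psi> d))" for a b c d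
  have \<psi>quad': "\<psi> (quad' a b c d) = quad (\<psi> a) (\<psi> b) (\<psi> c) (\<psi> d)" for a b c d
    unfolding quad'_def by (intro \<psi>(2) closed subsetD[OF \<psi>(1)] rangeI)
  have comp: "Vector_Spaces.linear pm_scale pm_scale (\<lambda>x. \<phi> (f (\<psi> x)))"
    if "Vector_Spaces.linear scale scale f" for f
    using Vector_Spaces.linear_compose[OF Vector_Spaces.linear_compose[OF lin(2) that] lin(1)]
    by (simp add: o_def)
  have quad'_left: "quad' (quad' a b c d) e f g =
      \<phi> (quad (quad (\<psi> a) (\<psi> b) (\<psi> c) (\<psi> d)) (\<psi> e) (\<psi> f) (\<psi> g))" for a b c d e f g
    by (subst quad'_def) (simp only: \<psi>quad')
  have quad'_right: "quad' e (quad' a b c d) f g =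
      \<phi> (quad (\<psi> e) (quad (\<psi> a) (\<psi> b) (\<psi> c) (\<psi> d)) (\<psi> f) (\<psi> g))" for a b c d e f g
    by (subst quad'_def) (simp only: \<psi>quad')
  have JQS': "jordan_quadruple_system pm_scale quad'"
  proof (intro jordan_quadruple_system.intro vector_space_pm_scale
      jordan_quadruple_system_axioms.intro, goal_cases)
    case 1 show ?case unfolding quad'_def by (rule comp[OF Q.quad_linear1])
  next
    case 2 show ?case unfolding quad'_def by (rule comp[OF Q.quad_linear2])
  next
    case 3 show ?case unfolding quad'_def by (rule comp[OF Q.quad_linear3])
  next
    case 4 show ?case unfolding quad'_def by (rule comp[OF Q.quad_linear4])
  next
    case (5 a b c d) show ?case unfolding quad'_def by (rule arg_cong[OF Q.quad_symmetric])
  next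
    case (6 a b c d e f g)
    show ?case
      unfolding quad'_left quad'_right \<phi>.add[symmetric] \<phi>.diff[symmetric] Q.quad_identity_i by (rule \<phi>.zero)
  next
    case (7 a b c d e f g)
    show ?case
      unfolding quad'_left quad'_right \<phi>.add[symmetric] \<phi>.diff[symmetric] Q.quad_identity_ii by (rule \<phi>.zero)
  next
    case (8 a b c d e f g)
    show ?case
      unfolding quad'_left quad'_right \<phi>.add[symmetric] \<phi>.diff[symmetric] Q.quad_identity_iii by (rule \<phi>.zero)
  qed
  have mono': "\<psi> (eval_monomial quad' (\<lambda>x. \<phi> (v x)) m) = eval_monomial quad v m" for m
  proof (induction m)
    case (Var x)
    then show ?case using \<psi>(2)[OF mono_S[of "Var x"]] by simp
  qed (simp add: \<psi>quad')
  have "eval_identity pm_scale quad' (\<lambda>x. \<phi> (v x)) I = 0"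
    using assms(1) JQS' by (simp add: JQS_consequence_def)
  then have "\<psi> (eval_identity pm_scale quad' (\<lambda>x. \<phi> (v x)) I) = 0" by (simp add: \<psi>.zero)
  then show ?thesis
    by (simp add: eval_identity_def \<psi>.sum \<psi>.scale mono')
qed

text \<open>The five identities are multihomogeneous of degree 10.\<close>

primrec vars_monomial :: "'x quad_monomial \<Rightarrow> 'x multiset" where
    "vars_monomial (Var x) = {#x#}"
  | "vars_monomial \<langle>p, q, r, s\<rangle> =
      vars_monomial p + vars_monomial q + vars_monomial r + vars_monomial s"

lemma vars_map_monomial: "vars_monomial (map_quad_monomial f m) = image_mset f (vars_monomial m)"
  by (induction m) auto

lemma vars_alternating_sum:
  assumes "\<forall>(k, m)\<in>set ts. vars_monomial m = replicate_mset j 0 + mset [1..<Suc n]"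
    and "m \<in> Poly_Mapping.keys (alternating_sum n ts)"
  shows "vars_monomial m = replicate_mset j 0 + mset [1..<Suc n]"
proof -
  have sum_list_keys: "x \<in> Poly_Mapping.keys (sum_list xs) \<Longrightarrow> \<exists>p\<in>set xs. x \<in> Poly_Mapping.keys p"
    for x and xs :: "quad_identity list"
    by (induction xs) (use keys_add in fastforce)+
  obtain \<sigma> where \<sigma>: "\<sigma> permutes {1..n}" and
    "m \<in> Poly_Mapping.keys (\<Sum>(k, m)\<leftarrow>ts.
      Poly_Mapping.single (map_quad_monomial \<sigma> m) (of_int (sign \<sigma> * k) :: rat))"
    using assms(2) keys_sum unfolding alternating_sum_def by fastforce
  then obtain k m' where m': "(k, m') \<in> set ts"
    "m \<in> Poly_Mapping.keys (Poly_Mapping.single (map_quad_monomial \<sigma> m') (of_int (sign \<sigma> * k) :: rat))"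
    by (fastforce dest: sum_list_keys)
  then have "m = map_quad_monomial \<sigma> m'" by (auto split: if_splits)
  moreover have "vars_monomial m' = replicate_mset j 0 + mset [1..<Suc n]"
    using assms(1) m'(1) by auto
  moreover have "image_mset \<sigma> (mset_set {1..n}) = mset_set {1..n}"
    using \<sigma> by (simp add: image_mset_mset_set permutes_inj_on permutes_image)
  moreover have "mset [1..<Suc n] = mset_set {1..n}"
    by (simp only: mset_upt atLeastLessThanSuc_atLeastAtMost)
  moreover have "\<sigma> 0 = 0" using \<sigma> by (auto simp: permutes_def)
  ultimately show ?thesis by (simp add: vars_map_monomial)
qed

lemma vars_identity1:
  assumes "m \<in> Poly_Mapping.keys identity1"
  shows "vars_monomial m = replicate_mset 6 0 + mset [1..<Suc 4]"
  using assms unfolding identity1_def Let_def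
  by (rule vars_alternating_sum[rotated]) (simp add: upt_rec numeral_eq_Suc add_mset_commute)

lemma vars_identity2:
  assumes "m \<in> Poly_Mapping.keys identity2"
  shows "vars_monomial m = replicate_mset 5 0 + mset [1..<Suc 5]"
  using assms unfolding identity2_def Let_def
  by (rule vars_alternating_sum[rotated]) (simp add: upt_rec numeral_eq_Suc add_mset_commute)

lemma vars_identity3:
  assumes "m \<in> Poly_Mapping.keys identity3"
  shows "vars_monomial m = replicate_mset 5 0 + mset [1..<Suc 5]"
  using assms unfolding identity3_def Let_def
  by (rule vars_alternating_sum[rotated]) (simp add: upt_rec numeral_eq_Suc add_mset_commute)

lemma vars_identity4:
  assumes "m \<in> Poly_Mapping.keys identity4"
  shows "vars_monomial m = replicate_mset 5 0 + mset [1..<Suc 5]"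
  using assms unfolding identity4_def Let_def
  by (rule vars_alternating_sum[rotated]) (simp add: upt_rec numeral_eq_Suc add_mset_commute)

lemma vars_identity5:
  assumes "m \<in> Poly_Mapping.keys identity5"
  shows "vars_monomial m = replicate_mset 4 0 + mset [1..<Suc 6]"
  using assms unfolding identity5_def Let_def
  by (rule vars_alternating_sum[rotated]) (simp add: upt_rec numeral_eq_Suc add_mset_commute)

end

(* Over the free associative algebra A on letters 0 (for a) and 1, ..., n, consider the operation
   tetrad + omega, where the four-linear form omega takes values in a new central line.  It is a
   Jordan quadruple system as soon as omega satisfies finitely many linear equations, and an
   identity of the tetrad fails in it if the omega part of the identity does not vanish.
   It suffices to look for omega in degree 10, of degree at most 1 in each of the letters 1, ..., n
   and alternating in them; such a form is a function of the pattern of a's and non-a's in its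
   arguments.  Sparse solutions of the equations with n = 4 and n = 5, found by computer, are
   table4 and table5.  The first one detects the identities (1), (3), (4), the second one
   (2), (5); one of the alternating variables of (3), (4), (5) is specialised to a.  The
   alternating sums then reduce to one word per pattern, up to sign, both for the tetrad and for omega. *)
theory Submission
  imports Defs
begin

section \<open>Expansion of quadruple monomials into words\<close>

text \<open>The obstacle is that the axioms concern arbitrary elements, whereas a computation sees
  finitely many words. In a nested bracket the inner value of omega is central and is annihilated by
  the outer bracket, so each axiom sees omega only once per term, with a tetrad inserted in one
  argument. The axioms thus become cocycle conditions on omega, and the new system is a central
  extension of the tetrad. Multilinearity reduces these conditions to words, and alternation reduces
  words to patterns. Brackets of letters have length 1 modulo 3, so the system may be confined to
  words of such lengths. Seven such lengths with sum 10 are one 4 and six 1, which leaves seven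
  cases per axiom; without the restriction, lengths such as 2 + 2 + 2 + 1 + 1 + 1 + 1 would impose
  further equations. Degree 10 is the degree of three nested brackets.\<close>

definition concat4 :: "'x list list \<Rightarrow> 'x list list \<Rightarrow> 'x list list \<Rightarrow> 'x list list \<Rightarrow> 'x list list" where
  "concat4 A B C D = [a @ b @ c @ d. a \<leftarrow> A, b \<leftarrow> B, c \<leftarrow> C, d \<leftarrow> D]"

primrec words :: "'x quad_monomial \<Rightarrow> 'x list list" where
    "words (Var x) = [[x]]"
  | "words \<langle>p, q, r, s\<rangle> =
      concat4 (words p) (words q) (words r) (words s) @
      concat4 (words s) (words r) (words q) (words p)"

text \<open>The ring need not have a unit, so the value at \<open>[]\<close> is junk.\<close>

fun list_prod :: "'a::ring list \<Rightarrow> 'a" where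
  "list_prod [] = 0"
| "list_prod [x] = x"
| "list_prod (x # y # zs) = x * list_prod (y # zs)"

lemma list_prod_Cons: "xs \<noteq> [] \<Longrightarrow> list_prod (x # xs) = x * list_prod xs"
  by (cases xs) auto

lemma list_prod_append:
  "xs \<noteq> [] \<Longrightarrow> ys \<noteq> [] \<Longrightarrow> list_prod (xs @ ys) = list_prod xs * list_prod ys"
  by (induction xs rule: list_prod.induct) (auto simp: list_prod_Cons mult.assoc)

lemma list_prod_eq_prod_list: "xs \<noteq> [] \<Longrightarrow> list_prod xs = prod_list (xs :: 'a::ring_1 list)"
  by (induction xs rule: list_prod.induct) auto

lemma concat4_nonempty: "[] \<notin> set A \<Longrightarrow> [] \<notin> set (concat4 A B C D)"
  by (auto simp: concat4_def)

lemma words_nonempty: "[] \<notin> set (words m)"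
  by (induction m) (auto simp: concat4_nonempty)

lemma sum_list_concat:
  "(\<Sum>x\<leftarrow>concat xss. f x) = (\<Sum>xs\<leftarrow>xss. \<Sum>x\<leftarrow>xs. (f x :: 'a::monoid_add))"
  by (induction xss) auto

text \<open>Multiplicativity is asked of nonempty words only: in a ring without unit,
  \<open>list_prod\<close> has no sensible value at \<open>[]\<close>.\<close>

lemma sum_list_concat4:
  fixes f :: "'x list \<Rightarrow> 'a::semiring_0"
  assumes f: "\<And>xs ys. xs \<noteq> [] \<Longrightarrow> ys \<noteq> [] \<Longrightarrow> f (xs @ ys) = f xs * f ys"
    and ne: "[] \<notin> set A" "[] \<notin> set B" "[] \<notin> set C" "[] \<notin> set D"
  shows "(\<Sum>w\<leftarrow>concat4 A B C D. f w) =
    (\<Sum>w\<leftarrow>A. f w) * (\<Sum>w\<leftarrow>B. f w) * (\<Sum>w\<leftarrow>C. f w) * (\<Sum>w\<leftarrow>D. f w)"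
proof -
  have "(\<Sum>w\<leftarrow>concat4 A B C D. f w) = (\<Sum>a\<leftarrow>A. \<Sum>b\<leftarrow>B. \<Sum>c\<leftarrow>C. \<Sum>d\<leftarrow>D. f (a @ b @ c @ d))"
    by (simp add: concat4_def sum_list_concat o_def)
  also have "\<dots> = (\<Sum>a\<leftarrow>A. \<Sum>b\<leftarrow>B. \<Sum>c\<leftarrow>C. \<Sum>d\<leftarrow>D. f a * (f b * (f c * f d)))"
    using ne
    by (intro arg_cong[where f = sum_list] map_cong refl) (metis f append_is_Nil_conv)
  also have "\<dots> = (\<Sum>w\<leftarrow>A. f w) * (\<Sum>w\<leftarrow>B. f w) * (\<Sum>w\<leftarrow>C. f w) * (\<Sum>w\<leftarrow>D. f w)"
    by (simp add: sum_list_const_mult sum_list_mult_const mult.assoc)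
  finally show ?thesis .
qed

lemma eval_tetrad: "eval_monomial tetrad v m = (\<Sum>w\<leftarrow>words m. list_prod (map v w))"
proof (induction m)
  case (Quad p q r s)
  have "(\<Sum>w\<leftarrow>concat4 (words p) (words q) (words r) (words s). list_prod (map v w)) =
    (\<Sum>w\<leftarrow>words p. list_prod (map v w)) * (\<Sum>w\<leftarrow>words q. list_prod (map v w)) *
    (\<Sum>w\<leftarrow>words r. list_prod (map v w)) * (\<Sum>w\<leftarrow>words s. list_prod (map v w))" for p q r s
    by (intro sum_list_concat4 words_nonempty) (simp add: list_prod_append)
  then show ?case
    unfolding eval_monomial.simps Quad words.simps by (simp add: tetrad_def)
qed simp

lemma eval_map_quad_monomial:
  "eval_monomial quad v (map_quad_monomial \<sigma> m) = eval_monomial quad (v \<circ> \<sigma>) m"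
  by (induction m) auto

section \<open>Alternating sums\<close>

definition expand :: "('x \<Rightarrow> 'w list) \<Rightarrow> (int \<times> 'x) list \<Rightarrow> (int \<times> 'w) list" where
  "expand f ts = [(k, w). (k, m) \<leftarrow> ts, w \<leftarrow> f m]"

text \<open>Three instances are used: an arbitrary associative algebra, the word algebra, and
  \<open>rat\<close> itself as the target of linear forms.\<close>

locale rat_vector_space = vector_space scale for scale :: "rat \<Rightarrow> 'b::ab_group_add \<Rightarrow> 'b"
begin

abbreviation combination :: "('x \<Rightarrow> 'b) \<Rightarrow> (int \<times> 'x) list \<Rightarrow> 'b" where
  "combination f ts \<equiv> (\<Sum>(k, m)\<leftarrow>ts. scale (of_int k) (f m))"

lemma scale_sum_list: "scale c (\<Sum>x\<leftarrow>xs. f x) = (\<Sum>x\<leftarrow>xs. scale c (f x))"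
  by (induction xs) (auto simp: scale_right_distrib)

lemma combination_expand: "combination f (expand g ts) = combination (\<lambda>m. \<Sum>w\<leftarrow>g m. f w) ts"
  by (induction ts) (auto simp: expand_def scale_sum_list sum_list_concat o_def)

lemma combination_neutral:
  "\<forall>(k, x)\<in>set L. f x = 0 \<Longrightarrow> combination f L = 0"
  by (induction L) auto

lemma combination_cong:
  "\<forall>(k, x)\<in>set L. f x = g x \<Longrightarrow> combination f L = combination g L"
  by (induction L) auto

lemma combination_scale:
  "combination (\<lambda>x. scale c (f x)) L = scale c (combination f L)"
  by (induction L) (auto simp: scale_right_distrib mult.commute)

text \<open>Keys can cancel in a sum of identities; over a common finite superset of the keys,
  evaluation is visibly additive.\<close>

lemma eval_identity_superset:
  assumes "finite A" "Poly_Mapping.keys I \<subseteq> A"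
  shows "eval_identity scale quad v I =
    (\<Sum>m\<in>A. scale (Poly_Mapping.lookup I m) (eval_monomial quad v m))"
  unfolding eval_identity_def using assms
  by (intro sum.mono_neutral_left) (auto simp: in_keys_iff)

lemma eval_identity_add:
  "eval_identity scale quad v (I + J) = eval_identity scale quad v I + eval_identity scale quad v J"
  using keys_add[of I J]
  by (simp add: eval_identity_superset[of "Poly_Mapping.keys I \<union> Poly_Mapping.keys J"]
      lookup_add scale_left_distrib sum.distrib)

lemma eval_identity_single:
  "eval_identity scale quad v (Poly_Mapping.single m c) = scale c (eval_monomial quad v m)"
  by (simp add: eval_identity_superset[of "{m}"])

lemma eval_identity_zero [simp]: "eval_identity scale quad v 0 = 0"
  by (simp add: eval_identity_def)

lemma eval_identity_sum:
  "eval_identity scale quad v (\<Sum>x\<in>A. I x) = (\<Sum>x\<in>A. eval_identity scale quad v (I x))"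
  by (induction A rule: infinite_finite_induct) (auto simp: eval_identity_add)

lemma eval_identity_sum_list:
  "eval_identity scale quad v (\<Sum>x\<leftarrow>xs. I x) = (\<Sum>x\<leftarrow>xs. eval_identity scale quad v (I x))"
  by (induction xs) (auto simp: eval_identity_add)

lemma eval_identity_alternating_sum:
  "eval_identity scale quad v (alternating_sum n ts) =
    (\<Sum>\<sigma> | \<sigma> permutes {1..n}. scale (of_int (sign \<sigma>))
      (combination (eval_monomial quad (v \<circ> \<sigma>)) ts))"
  unfolding alternating_sum_def eval_identity_sum eval_identity_sum_list scale_sum_list
  by (intro sum.cong arg_cong[where f = sum_list] map_cong refl)
    (auto simp: eval_identity_single eval_map_quad_monomial)

end

section \<open>Normal forms of words under renaming of their labels\<close>

text \<open>The letters \<open>1, \<dots>, 6\<close> are labels; \<open>0\<close> stands for the repeated variable, and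
  \<open>7, 8, 9\<close> serve as separators below.\<close>

abbreviation is_label :: "nat \<Rightarrow> bool" where
  "is_label x \<equiv> 0 < x \<and> x < 7"

text \<open>Labels are renamed, not moved: when \<open>x\<close> is met where \<open>i\<close> is
  due, \<open>i\<close> and \<open>x\<close> are swapped in the rest of the word. The pattern of
  zeros, separators and labels survives. For distinct labels the resulting word depends on this
  pattern only.\<close>

function sort_labels :: "nat \<Rightarrow> nat list \<Rightarrow> int \<times> nat list" where
  "sort_labels i [] = (1, [])"
| "sort_labels i (x # xs) =
    (if \<not> is_label x then (case sort_labels i xs of (s, ys) \<Rightarrow> (s, x # ys))
     else if x = i then (case sort_labels (Suc i) xs of (s, ys) \<Rightarrow> (s, x # ys))
     else (case sort_labels (Suc i) (map (transpose i x) xs) of (s, ys) \<Rightarrow> (- s, i # ys)))"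
  by pat_completeness auto
termination by (relation "measure (length \<circ> snd)") auto

definition labels_ok :: "nat \<Rightarrow> nat list \<Rightarrow> bool" where
  "labels_ok n w \<longleftrightarrow> distinct (filter is_label w) \<and> list_all (\<lambda>x. is_label x \<longrightarrow> x \<le> n) w"

fun cancels :: "(int \<times> 'w) list \<Rightarrow> bool" where
  "cancels [] \<longleftrightarrow> True"
| "cancels ((c, w) # L) \<longleftrightarrow>
    c + (\<Sum>(c', w')\<leftarrow>L. if w' = w then c' else 0) = 0 \<and> cancels [p \<leftarrow> L. snd p \<noteq> w]"

definition sort_term :: "int \<times> nat list \<Rightarrow> int \<times> nat list" where
  "sort_term = (\<lambda>(k, w). case sort_labels 1 w of (s, w') \<Rightarrow> (k * s, w'))"

lemma map_transpose_label_free: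
  assumes "i \<notin> set us" "x \<notin> set us"
  shows "map (transpose i x) us = us"
  using assms by (intro map_idI) (auto simp: transpose_def)

text \<open>Since the label \<open>x\<close> occurs only at the head, the swap turns every
  \<open>i\<close> of the tail into \<open>x\<close> and creates no new \<open>i\<close>.\<close>

lemma labels_ok_transpose:
  assumes "distinct (filter is_label (x # xs))" "is_label x" "is_label i"
  shows "distinct (filter is_label (map (transpose i x) xs))"
    and "i \<notin> set (map (transpose i x) xs)"
proof -
  have "filter is_label (map (transpose i x) xs) = map (transpose i x) (filter is_label xs)"
    using assms(2,3) by (induction xs) (auto simp: transpose_def)
  then show "distinct (filter is_label (map (transpose i x) xs))"
    using assms by (simp add: distinct_map inj_on_subset[OF inj_transpose])
  show "i \<notin> set (map (transpose i x) xs)"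
    using assms by (auto simp: transpose_def split: if_splits)
qed

context rat_vector_space
begin

definition antisymmetric :: "nat \<Rightarrow> (nat list \<Rightarrow> 'b) \<Rightarrow> bool" where
  "antisymmetric n h \<longleftrightarrow>
    (\<forall>i\<in>{1..n}. \<forall>j\<in>{1..n}. i \<noteq> j \<longrightarrow> (\<forall>w. h (map (transpose i j) w) = - h w))"

text \<open>The labels of the sorted prefix \<open>us\<close> are below \<open>i\<close>, so
  swapping \<open>i\<close> and \<open>x\<close>, both at least \<open>i\<close>, leaves
  \<open>us\<close> alone and costs one sign.\<close>

lemma antisymmetric_sort_labels:
  assumes "antisymmetric n h" "1 \<le> i" "n \<le> 6"
    and "distinct (filter is_label w)" "\<And>x. x \<in> set w \<Longrightarrow> is_label x \<Longrightarrow> i \<le> x \<and> x \<le> n"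
    and "\<And>x. x \<in> set us \<Longrightarrow> is_label x \<Longrightarrow> x < i"
  shows "h (us @ w) = scale (of_int (fst (sort_labels i w))) (h (us @ snd (sort_labels i w)))"
  using assms(2-)
proof (induction i w arbitrary: us rule: sort_labels.induct)
  case (1 i)
  then show ?case by simp
next
  case (2 i x xs)
  show ?case
  proof (cases "is_label x")
    case False
    then show ?thesis
      using 2(1)[of "us @ [x]"] 2(4-) by (auto split: prod.splits)
  next
    case lab: True
    have le: "i \<le> x" "x \<le> n" using 2(7)[of x] lab by auto
    show ?thesis
    proof (cases "x = i")
      case True
      have "i \<notin> set xs" using 2(6) lab True by auto
      then have "Suc i \<le> y \<and> y \<le> n" if "y \<in> set xs" "is_label y" for y
        using 2(7)[of y] that by (auto simp: le_less)
      moreover have "y < Suc i" if "y \<in> set (us @ [x])" "is_label y" for y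
        using 2(8)[of y] that True by auto
      ultimately show ?thesis
        using 2(2)[of "us @ [x]"] 2(4-6) lab True by (auto split: prod.splits)
    next
      case False
      have us: "i \<notin> set us" "x \<notin> set us"
        using 2(8)[of i] 2(8)[of x] lab le 2(4,5) by auto
      have il: "is_label i" using le 2(4,5) by auto
      have "i \<in> {1..n}" "x \<in> {1..n}" "i \<noteq> x" using le 2(4) False by auto
      then have "h (map (transpose i x) (us @ x # xs)) = - h (us @ x # xs)"
        using assms(1) unfolding antisymmetric_def by blast
      then have "h (us @ x # xs) = - h (map (transpose i x) (us @ x # xs))"
        by simp
      also have "map (transpose i x) (us @ x # xs) = (us @ [i]) @ map (transpose i x) xs"
        using us by (simp add: map_transpose_label_free)
      also have "h \<dots> = scale (of_int (fst (sort_labels (Suc i) (map (transpose i x) xs))))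
          (h ((us @ [i]) @ snd (sort_labels (Suc i) (map (transpose i x) xs))))"
      proof (rule 2(3))
        show "\<not> \<not> is_label x" "x \<noteq> i" using lab False by auto
        show "1 \<le> Suc i" "n \<le> 6" using 2(5) by auto
        show "distinct (filter is_label (map (transpose i x) xs))"
          using labels_ok_transpose[OF 2(6) lab il] by simp
        show "y < Suc i" if "y \<in> set (us @ [i])" "is_label y" for y
          using 2(8)[of y] that by auto
        show "Suc i \<le> y \<and> y \<le> n" if y: "y \<in> set (map (transpose i x) xs)" "is_label y" for y
        proof -
          have "y \<noteq> i" using labels_ok_transpose(2)[OF 2(6) lab il] y by metis
          moreover obtain z where "z \<in> set xs" "y = transpose i x z" using y by auto
          then have "y = i \<or> y = x \<or> y \<in> set xs" by (auto simp: transpose_def)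
          then have "i \<le> y \<and> y \<le> n"
            using 2(7)[of y] le y(2) by (elim disjE) auto
          ultimately show ?thesis by auto
        qed
      qed
      finally show ?thesis
        using lab False by (simp split: prod.splits)
    qed
  qed
qed

lemma combination_sort_term:
  assumes "antisymmetric n h" "n \<le> 6" "list_all (\<lambda>(k, w). labels_ok n w) L"
  shows "combination h L = combination h (map sort_term L)"
  using assms(3)
proof (induction L)
  case (Cons p L)
  obtain k w where p: "p = (k, w)" by force
  have "h ([] @ w) = scale (of_int (fst (sort_labels 1 w))) (h ([] @ snd (sort_labels 1 w)))"
    using assms Cons.prems
    by (intro antisymmetric_sort_labels) (auto simp: p labels_ok_def list_all_iff)
  then show ?case
    using Cons by (auto simp: p sort_term_def split: prod.splits)
qed simp

lemma combination_cancels: "cancels L \<Longrightarrow> combination f L = 0"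
proof (induction L rule: cancels.induct)
  case (2 c w L)
  have "combination f L =
      scale (of_int (\<Sum>(c', w')\<leftarrow>L. if w' = w then c' else 0)) (f w) + combination f [p \<leftarrow> L. snd p \<noteq> w]"
    by (induction L) (auto simp: scale_left_distrib)
  moreover have "scale (of_int c) (f w) +
      scale (of_int (\<Sum>(c', w')\<leftarrow>L. if w' = w then c' else 0)) (f w) = 0"
    using 2(2) by (simp flip: scale_left_distrib of_int_add)
  ultimately show ?case
    using 2 by (simp add: add.assoc[symmetric])
qed simp

section \<open>Alternating sums over the labels, and validity of the identities for the
  tetrad\<close>

definition alternation :: "nat \<Rightarrow> (nat list \<Rightarrow> 'b) \<Rightarrow> nat list \<Rightarrow> 'b" where
  "alternation n f w = (\<Sum>\<sigma> | \<sigma> permutes {1..n}. scale (of_int (sign \<sigma>)) (f (map \<sigma> w)))"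

text \<open>Composing the summation index with a transposition on the right permutes the summands
  and changes every sign.\<close>

lemma antisymmetric_alternation: "antisymmetric n (alternation n f)"
  unfolding antisymmetric_def
proof safe
  fix i j w assume ij: "i \<in> {1..n}" "j \<in> {1..n}" "i \<noteq> j"
  have t: "transpose i j permutes {1..n}" using ij by (intro permutes_swap_id)
  have "alternation n f w =
      (\<Sum>\<sigma> | \<sigma> permutes {1..n}. scale (of_int (sign (\<sigma> \<circ> transpose i j))) (f (map (\<sigma> \<circ> transpose i j) w)))"
    unfolding alternation_def by (rule sum_permutations_compose_right[OF t])
  also have "\<dots> = (\<Sum>\<sigma> | \<sigma> permutes {1..n}. - scale (of_int (sign \<sigma>)) (f (map \<sigma> (map (transpose i j) w))))"
  proof (intro sum.cong refl)
    fix \<sigma> assume "\<sigma> \<in> {\<sigma>. \<sigma> permutes {1..n}}"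
    then have "permutation \<sigma>" by (auto intro: permutation_permutes[THEN iffD2])
    then have "sign (\<sigma> \<circ> transpose i j) = - sign \<sigma>"
      using ij by (simp add: sign_compose permutation_swap_id sign_swap_id)
    then show "scale (of_int (sign (\<sigma> \<circ> transpose i j))) (f (map (\<sigma> \<circ> transpose i j) w)) =
        - scale (of_int (sign \<sigma>)) (f (map \<sigma> (map (transpose i j) w)))"
      by simp
  qed
  finally show "alternation n f (map (transpose i j) w) = - alternation n f w"
    by (simp add: alternation_def sum_negf)
qed

lemma combination_alternation:
  "combination (alternation n f) L =
    (\<Sum>\<sigma> | \<sigma> permutes {1..n}. scale (of_int (sign \<sigma>)) (combination (\<lambda>w. f (map \<sigma> w)) L))"
  by (induction L)
    (auto simp: alternation_def scale_right_distrib sum.distrib scale_sum_right mult.commute)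

end

text \<open>The permutations never enter the test: each word may be replaced by its signed normal
  form, and cancellation of formal words gives vanishing in every algebra at once.\<close>

lemma satisfied_by_tetrad_alternating_sum:
  assumes "n \<le> 6" "list_all (\<lambda>(k, w). labels_ok n w) (expand words ts)"
    "cancels (map sort_term (expand words ts))"
  shows "satisfied_by_tetrad TYPE('a::ring) (alternating_sum n ts)"
  unfolding satisfied_by_tetrad_def
proof safe
  fix scale :: "rat \<Rightarrow> 'a \<Rightarrow> 'a" and v
  assume "associative_algebra scale"
  then interpret associative_algebra scale .
  interpret rat_vector_space scale ..
  have "eval_identity scale tetrad v (alternating_sum n ts) =
      combination (alternation n (\<lambda>w. list_prod (map v w))) (expand words ts)"
    unfolding combination_alternation eval_identity_alternating_sum eval_tetrad combination_expand
    by (simp add: o_def)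
  also have "\<dots> = 0"
    unfolding combination_sort_term[OF antisymmetric_alternation assms(1,2)]
    by (rule combination_cancels[OF assms(3)])
  finally show "eval_identity scale tetrad v (alternating_sum n ts) = 0" .
qed


lemma satisfied_by_tetrad_identity1: "satisfied_by_tetrad TYPE('a::ring) identity1"
  unfolding identity1_def Let_def by (rule satisfied_by_tetrad_alternating_sum; code_simp)

lemma satisfied_by_tetrad_identity2: "satisfied_by_tetrad TYPE('a::ring) identity2"
  unfolding identity2_def Let_def by (rule satisfied_by_tetrad_alternating_sum; code_simp)

lemma satisfied_by_tetrad_identity3: "satisfied_by_tetrad TYPE('a::ring) identity3"
  unfolding identity3_def Let_def by (rule satisfied_by_tetrad_alternating_sum; code_simp)

lemma satisfied_by_tetrad_identity4: "satisfied_by_tetrad TYPE('a::ring) identity4"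
  unfolding identity4_def Let_def by (rule satisfied_by_tetrad_alternating_sum; code_simp)

lemma satisfied_by_tetrad_identity5: "satisfied_by_tetrad TYPE('a::ring) identity5"
  unfolding identity5_def Let_def by (rule satisfied_by_tetrad_alternating_sum; code_simp)

section \<open>The free associative algebra\<close>

text \<open>The product of \<open>\<Rightarrow>\<^sub>0\<close> is convolution over an additive
  monoid. With concatenation written as addition, \<open>word_algebra\<close> is the free unital
  algebra on the letters, with unit the empty word \<open>0\<close>.\<close>

datatype word = Word (letters: "nat list")

instantiation word :: monoid_add
begin

definition zero_word :: word where "0 = Word []"
definition plus_word :: "word \<Rightarrow> word \<Rightarrow> word" where "u + v = Word (letters u @ letters v)"

instance
  by standard (auto simp: zero_word_def plus_word_def)

end

type_synonym word_algebra = "word \<Rightarrow>\<^sub>0 rat"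

definition word_scale :: "rat \<Rightarrow> word_algebra \<Rightarrow> word_algebra" where
  "word_scale r p = Poly_Mapping.single 0 r * p"

lemma lookup_word_scale [simp]:
  "Poly_Mapping.lookup (word_scale r p) w = r * Poly_Mapping.lookup p w"
  unfolding word_scale_def mult_map_scale_conv_mult[symmetric]
  by (simp add: Poly_Mapping.map.rep_eq when_def)

lemma poly_mapping_expansion:
  "p = (\<Sum>u\<in>Poly_Mapping.keys p. Poly_Mapping.single u (Poly_Mapping.lookup p u))"
proof (rule poly_mapping_eqI)
  fix k
  have "(\<Sum>u\<in>Poly_Mapping.keys p. Poly_Mapping.lookup (Poly_Mapping.single u (Poly_Mapping.lookup p u)) k) =
      (\<Sum>u\<in>Poly_Mapping.keys p. if k = u then Poly_Mapping.lookup p u else 0)"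
    by (intro sum.cong refl) (auto simp: lookup_single)
  also have "\<dots> = Poly_Mapping.lookup p k"
    by (simp add: in_keys_iff)
  finally show "Poly_Mapping.lookup p k = Poly_Mapping.lookup
      (\<Sum>u\<in>Poly_Mapping.keys p. Poly_Mapping.single u (Poly_Mapping.lookup p u)) k"
    unfolding lookup_sum by (rule sym)
qed

interpretation word: associative_algebra word_scale
proof unfold_locales
  fix r and x y :: word_algebra
  show "word_scale r x * y = word_scale r (x * y)"
    by (simp add: word_scale_def mult.assoc)
  \<comment> \<open>Constants commute with single words, hence by expansion with every
    element.\<close>
  have "x * Poly_Mapping.single 0 r = Poly_Mapping.single 0 r * x"
  proof -
    have "(\<Sum>u\<in>A. Poly_Mapping.single u (c u)) * Poly_Mapping.single 0 r =
        Poly_Mapping.single 0 r * (\<Sum>u\<in>A. Poly_Mapping.single u (c u))" for A and c :: "word \<Rightarrow> rat"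
      by (simp add: sum_distrib_left sum_distrib_right mult_single mult.commute)
    then show ?thesis
      by (metis poly_mapping_expansion)
  qed
  then show "x * word_scale r y = word_scale r (x * y)"
    by (metis word_scale_def mult.assoc)
qed (auto intro!: poly_mapping_eqI simp: lookup_add algebra_simps)

interpretation word: rat_vector_space word_scale ..

interpretation rat: rat_vector_space "(*) :: rat \<Rightarrow> rat \<Rightarrow> rat"
  by unfold_locales (auto simp: algebra_simps)

abbreviation monomial :: "nat list \<Rightarrow> word_algebra" where
  "monomial u \<equiv> Poly_Mapping.single (Word u) 1"

lemma prod_list_monomial:
  "prod_list (map (\<lambda>i. monomial (ws i)) w) = monomial (concat (map ws w))"
  by (induction w) (auto simp: mult_single plus_word_def zero_word_def simp flip: single_one)

lemma word_expansion: "p = (\<Sum>u\<in>Poly_Mapping.keys p. word_scale (Poly_Mapping.lookup p u) (monomial (letters u)))"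
  by (rule trans[OF poly_mapping_expansion[of p]]) (simp add: word_scale_def mult_single)

text \<open>An entry \<open>(c, e)\<close> stands for the whole orbit of \<open>e\<close>: the
  coefficient at \<open>map \<sigma> e\<close> is weighted with \<open>c\<close> times the sign of
  \<sigma>. The form is thus alternating by construction, and one entry per pattern is
  enough.\<close>

definition form :: "nat \<Rightarrow> (int \<times> nat list) list \<Rightarrow> word_algebra \<Rightarrow> rat" where
  "form n T p = rat.combination
    (\<lambda>e. \<Sum>\<sigma> | \<sigma> permutes {1..n}. of_int (sign \<sigma>) * Poly_Mapping.lookup p (Word (map \<sigma> e))) T"

lemma form_add: "form n T (p + q) = form n T p + form n T q"
  by (induction T) (auto simp: form_def lookup_add sum.distrib algebra_simps)

lemma form_scale: "form n T (word_scale r p) = r * form n T p"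
proof -
  have "(\<Sum>\<sigma> | \<sigma> permutes {1..n}. of_int (sign \<sigma>) * Poly_Mapping.lookup (word_scale r p) (Word (map \<sigma> e))) =
      r * (\<Sum>\<sigma> | \<sigma> permutes {1..n}. of_int (sign \<sigma>) * Poly_Mapping.lookup p (Word (map \<sigma> e)))" for e
    unfolding sum_distrib_left by (intro sum.cong refl) simp
  then show ?thesis
    unfolding form_def by (induction T) (auto simp: distrib_left mult.left_commute)
qed

lemma form_zero [simp]: "form n T 0 = 0"
  by (induction T) (auto simp: form_def)

lemma form_sum: "form n T (\<Sum>x\<in>A. f x) = (\<Sum>x\<in>A. form n T (f x))"
  by (induction A rule: infinite_finite_induct) (auto simp: form_add)

lemma form_sum_list: "form n T (\<Sum>x\<leftarrow>xs. f x) = (\<Sum>x\<leftarrow>xs. form n T (f x))"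
  by (induction xs) (auto simp: form_add)

lemma form_monomial:
  "form n T (monomial u) = rat.combination (rat.alternation n (\<lambda>u'. of_bool (u = u'))) T"
  by (simp add: form_def rat.alternation_def lookup_single when_def of_bool_def)

section \<open>A quadruple operation twisted by a linear form\<close>

text \<open>The letters \<open>7, 8, 9\<close> separate the four arguments, so that a linear form on the free algebra
  gives a four-linear form.\<close>

definition border :: "(nat \<Rightarrow> 'a::ring) \<Rightarrow> 'a \<Rightarrow> 'a \<Rightarrow> 'a \<Rightarrow> 'a \<Rightarrow> 'a" where
  "border v x y z w = x * v 7 * y * v 8 * z * v 9 * w + w * v 7 * z * v 8 * y * v 9 * x"

definition concat_separated :: "nat list list \<Rightarrow> nat list list \<Rightarrow> nat list list \<Rightarrow> nat list list \<Rightarrow> nat list list"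
  where "concat_separated A B C D =
    concat4 (map (\<lambda>a. a @ [7]) A) (map (\<lambda>b. b @ [8]) B) (map (\<lambda>c. c @ [9]) C) D"

text \<open>Only the outermost bracket carries separators, since omega sees inner brackets through
  the tetrad alone; a variable has no omega part. The order 7, 8, 9 is kept in the reversed summand,
  which makes omega invariant under reversal of its arguments.\<close>

fun separated_words :: "nat quad_monomial \<Rightarrow> nat list list" where
  "separated_words (Var x) = []"
| "separated_words \<langle>p, q, r, s\<rangle> =
    concat_separated (words p) (words q) (words r) (words s) @
    concat_separated (words s) (words r) (words q) (words p)"

lemma border_eval_tetrad:
  fixes v :: "nat \<Rightarrow> 'a::ring_1"
  shows "border v (eval_monomial tetrad v p) (eval_monomial tetrad v q)
      (eval_monomial tetrad v r) (eval_monomial tetrad v s) =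
    (\<Sum>w\<leftarrow>separated_words \<langle>p, q, r, s\<rangle>. prod_list (map v w))"
proof -
  have eval: "eval_monomial tetrad v m = (\<Sum>w\<leftarrow>words m. prod_list (map v w))" for m
    unfolding eval_tetrad using words_nonempty[of m]
    by (intro arg_cong[where f = sum_list] map_cong list_prod_eq_prod_list refl) auto
  have "(\<Sum>w\<leftarrow>concat_separated (words p) (words q) (words r) (words s). prod_list (map v w)) =
      eval_monomial tetrad v p * v 7 * eval_monomial tetrad v q * v 8 *
      eval_monomial tetrad v r * v 9 * eval_monomial tetrad v s" for p q r s
    unfolding concat_separated_def
    by (subst sum_list_concat4)
      (auto simp: words_nonempty o_def sum_list_mult_const eval mult.assoc)
  then show ?thesis
    by (simp add: border_def)
qed

section \<open>The grading by length modulo 3 and the central extension\<close>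

definition graded :: "nat \<Rightarrow> word_algebra \<Rightarrow> bool" where
  "graded i p \<longleftrightarrow> (\<forall>u\<in>Poly_Mapping.keys p. length (letters u) mod 3 = i mod 3)"

lemma graded_add: "graded i p \<Longrightarrow> graded i q \<Longrightarrow> graded i (p + q)"
  using keys_add[of p q] by (auto simp: graded_def)

lemma graded_mult:
  assumes "graded i p" "graded j q"
  shows "graded (i + j) (p * q)"
  unfolding graded_def
proof
  fix u assume "u \<in> Poly_Mapping.keys (p * q)"
  then obtain a b where ab: "a \<in> Poly_Mapping.keys p" "b \<in> Poly_Mapping.keys q" "u = a + b"
    using keys_mult[of p q] by blast
  then have "length (letters a) mod 3 = i mod 3" "length (letters b) mod 3 = j mod 3"
    using assms by (auto simp: graded_def)
  then show "length (letters u) mod 3 = (i + j) mod 3"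
    unfolding ab plus_word_def word.sel length_append by (rule mod_add_cong)
qed

definition proj :: "word_algebra \<Rightarrow> word_algebra" where
  "proj = Poly_Mapping.mapp (\<lambda>u c. c when length (letters u) mod 3 = 1)"

lemma lookup_proj: "Poly_Mapping.lookup (proj p) u = (Poly_Mapping.lookup p u when length (letters u) mod 3 = 1)"
  by (auto simp: proj_def lookup_mapp when_def in_keys_iff)

lemma proj_add: "proj (p + q) = proj p + proj q"
  by (rule poly_mapping_eqI) (auto simp: lookup_proj lookup_add when_def)

lemma proj_scale: "proj (word_scale r p) = word_scale r (proj p)"
  by (rule poly_mapping_eqI) (auto simp: lookup_proj when_def)

lemma graded_proj: "graded 1 (proj p)"
  by (auto simp: graded_def lookup_proj in_keys_iff when_def split: if_splits)

lemma proj_graded: "graded 1 p \<Longrightarrow> proj p = p"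
  by (rule poly_mapping_eqI) (auto simp: lookup_proj graded_def in_keys_iff when_def)

lemma proj_single_zero: "proj (Poly_Mapping.single 0 c) = 0"
  by (rule poly_mapping_eqI) (auto simp: lookup_proj lookup_single zero_word_def when_def)

lemma graded_tetrad:
  assumes "graded 1 x" "graded 1 y" "graded 1 z" "graded 1 w"
  shows "graded 1 (tetrad x y z w)"
proof -
  have "graded (1 + 1 + 1 + 1) (tetrad x y z w)"
    unfolding tetrad_def by (intro graded_add graded_mult assms)
  moreover have "(1 + 1 + 1 + 1) mod 3 = (1 mod 3 :: nat)" by simp
  ultimately show ?thesis by (simp only: graded_def)
qed

abbreviation letter :: "nat \<Rightarrow> word_algebra" where
  "letter i \<equiv> monomial [i]"

text \<open>The empty word plays the role of a central element, since \<open>proj\<close> kills it.  Products of the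
  letters have length 1 modulo 3; the forms below are only required to satisfy the identities there.\<close>

definition twisted_quad ::
    "nat \<Rightarrow> (int \<times> nat list) list \<Rightarrow> word_algebra \<Rightarrow> word_algebra \<Rightarrow> word_algebra \<Rightarrow> word_algebra \<Rightarrow> word_algebra"
  where "twisted_quad n T x y z w = tetrad (proj x) (proj y) (proj z) (proj w) +
    Poly_Mapping.single 0 (form n T (border letter (proj x) (proj y) (proj z) (proj w)))"

text \<open>\<open>proj\<close> kills the omega part, so it is a homomorphism to the tetrad on words
  of length 1 modulo 3. This is why values of omega inside a bracket are lost.\<close>

lemma proj_twisted_quad:
  "proj (twisted_quad n T x y z w) = tetrad (proj x) (proj y) (proj z) (proj w)"
  by (simp add: twisted_quad_def proj_add proj_single_zero
      proj_graded[OF graded_tetrad[OF graded_proj graded_proj graded_proj graded_proj]])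

lemma proj_eval_twisted_quad:
  "proj (eval_monomial (twisted_quad n T) v m) = eval_monomial tetrad (proj \<circ> v) m"
  by (induction m) (auto simp: proj_twisted_quad)

text \<open>The valuation fixes the separators, so that \<open>border letter\<close> becomes
  evaluation of separated words at \<open>proj \<circ> v\<close>.\<close>

lemma combination_twisted_quad:
  assumes "\<And>i. i \<in> {7, 8, 9} \<Longrightarrow> v i = letter i" and "list_all (\<lambda>(k, m). \<exists>p q r s. m = \<langle>p, q, r, s\<rangle>) ts"
  shows "word.combination (eval_monomial (twisted_quad n T) v) ts =
    word.combination (eval_monomial tetrad (proj \<circ> v)) ts +
    Poly_Mapping.single 0 (rat.combination (\<lambda>w. form n T (prod_list (map (proj \<circ> v) w))) (expand separated_words ts))"
proof -
  define u where "u = proj \<circ> v"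
  have letter: "letter i = u i" if "i \<in> {7, 8, 9}" for i
    using that by (simp add: u_def assms(1) proj_graded graded_def)
  have border: "border letter = border u"
    by (intro ext) (simp add: border_def letter)
  have eval: "eval_monomial (twisted_quad n T) v \<langle>p, q, r, s\<rangle> =
      eval_monomial tetrad u \<langle>p, q, r, s\<rangle> +
      Poly_Mapping.single 0 (\<Sum>w\<leftarrow>separated_words \<langle>p, q, r, s\<rangle>. form n T (prod_list (map u w)))" for p q r s
    by (simp only: eval_monomial.simps twisted_quad_def proj_eval_twisted_quad border u_def[symmetric]
        border_eval_tetrad form_sum_list)
  have "word.combination (eval_monomial (twisted_quad n T) v) ts =
    word.combination (eval_monomial tetrad u) ts +
    Poly_Mapping.single 0 (rat.combination (\<lambda>m. \<Sum>w\<leftarrow>separated_words m. form n T (prod_list (map u w))) ts)"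
    using assms(2)
  proof (induction ts)
    case (Cons t ts)
    obtain k p q r s where t: "t = (k, \<langle>p, q, r, s\<rangle>)" using Cons.prems by auto
    have "word_scale c (Poly_Mapping.single 0 d) = Poly_Mapping.single 0 (c * d)" for c d
      by (simp add: word_scale_def mult_single)
    then show ?case
      using Cons
      by (simp add: t eval word.scale_right_distrib single_add del: eval_monomial.simps separated_words.simps)
  qed simp
  then show ?thesis
    by (simp only: rat.combination_expand u_def)
qed

section \<open>Reduction to words\<close>

text \<open>\<open>P\<close> and \<open>Q\<close> are the products before and after the single
  occurrence of \<open>j\<close>; they make the product linear in the value at
  \<open>j\<close>.\<close>

lemma prod_list_fun_upd:
  fixes v :: "'x \<Rightarrow> word_algebra"
  assumes "distinct w" "j \<in> set w"
  obtains P Q where "\<And>x. prod_list (map (v(j := x)) w) = P * x * Q"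
proof -
  obtain w1 w2 where w: "w = w1 @ j # w2" "j \<notin> set w1" "j \<notin> set w2"
    using assms by (metis split_list distinct.simps(2) distinct_append not_distinct_conv_prefix)
  have "map (v(j := x)) w1 = map v w1" "map (v(j := x)) w2 = map v w2" for x
    using w(2,3) by auto
  then have "prod_list (map (v(j := x)) w) = prod_list (map v w1) * x * prod_list (map v w2)" for x
    by (simp only: w(1) map_append list.map prod_list.append prod_list.Cons fun_upd_same mult.assoc)
  then show thesis by (rule that)
qed

lemma combination_form_fun_upd_sum:
  assumes "list_all (\<lambda>(k, w). distinct w \<and> j \<in> set w) L"
  shows "rat.combination (\<lambda>w. form n T (prod_list (map (v(j := \<Sum>u\<in>A. word_scale (c u) (f u))) w))) L =
    (\<Sum>u\<in>A. c u * rat.combination (\<lambda>w. form n T (prod_list (map (v(j := f u)) w))) L)"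
  using assms
proof (induction L)
  case (Cons t L)
  obtain k w where t: "t = (k, w)" by force
  then obtain P Q where PQ: "\<And>x. prod_list (map (v(j := x)) w) = P * x * Q"
    using Cons.prems prod_list_fun_upd[of w j v] by auto
  have "form n T (prod_list (map (v(j := \<Sum>u\<in>A. word_scale (c u) (f u))) w)) =
      (\<Sum>u\<in>A. c u * form n T (prod_list (map (v(j := f u)) w)))"
    by (simp add: PQ sum_distrib_left sum_distrib_right word.scale_mult_left word.scale_mult_right
        form_sum form_scale)
  moreover have "rat.combination (\<lambda>w. form n T (prod_list (map (v(j := \<Sum>u\<in>A. word_scale (c u) (f u))) w))) L =
      (\<Sum>u\<in>A. c u * rat.combination (\<lambda>w. form n T (prod_list (map (v(j := f u)) w))) L)"
    using Cons.IH Cons.prems by (simp del: fun_upd_apply)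
  ultimately show ?case
    unfolding t list.map sum_list.Cons prod.case
    by (simp only: sum.distrib distrib_left sum_distrib_left mult.left_commute)
qed simp

text \<open>The arguments are expanded into words one at a time: in the induction those below
  \<open>j\<close> are still arbitrary, and those from \<open>j\<close> to \<open>N - 1\<close> are
  words already.\<close>

lemma combination_form_eq_0:
  assumes L: "list_all (\<lambda>(k, w). distinct w \<and> {..<N} \<subseteq> set w) L"
    and words: "\<And>ws. (\<And>i. i < N \<Longrightarrow> length (ws i) mod 3 = 1) \<Longrightarrow> (\<And>i. N \<le> i \<Longrightarrow> ws i = [i]) \<Longrightarrow>
      rat.combination (\<lambda>w. form n T (monomial (concat (map ws w)))) L = 0"
    and v: "\<And>i. i < N \<Longrightarrow> graded 1 (v i)" "\<And>i. N \<le> i \<Longrightarrow> v i = letter i"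
  shows "rat.combination (\<lambda>w. form n T (prod_list (map v w))) L = 0"
proof -
  have "rat.combination (\<lambda>w. form n T (prod_list (map v w))) L = 0"
    if "j \<le> N" "\<And>i. i < j \<Longrightarrow> graded 1 (v i)"
      "\<And>i. j \<le> i \<Longrightarrow> i < N \<Longrightarrow> \<exists>u. length u mod 3 = 1 \<and> v i = monomial u"
      "\<And>i. N \<le> i \<Longrightarrow> v i = letter i" for j v
    using that
  proof (induction j arbitrary: v)
    case 0
    have "\<exists>u. v i = monomial u \<and> (i < N \<longrightarrow> length u mod 3 = 1) \<and> (N \<le> i \<longrightarrow> u = [i])" for i
      using 0(3)[of i] 0(4)[of i] by (cases "i < N") auto
    then obtain ws where ws: "\<And>i. v i = monomial (ws i)" "\<And>i. i < N \<Longrightarrow> length (ws i) mod 3 = 1"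
      "\<And>i. N \<le> i \<Longrightarrow> ws i = [i]" by metis
    have "v = (\<lambda>i. monomial (ws i))" using ws(1) by auto
    then show ?case
      using words[of ws] ws(2,3) by (simp add: prod_list_monomial)
  next
    case (Suc j)
    have "rat.combination (\<lambda>w. form n T (prod_list (map (v(j := monomial (letters u))) w))) L = 0"
      if "u \<in> Poly_Mapping.keys (v j)" for u
    proof (rule Suc.IH)
      show "j \<le> N" using Suc.prems(1) by simp
      show "graded 1 ((v(j := monomial (letters u))) i)" if "i < j" for i
        using Suc.prems(2)[of i] that by simp
      show "\<exists>u'. length u' mod 3 = 1 \<and> (v(j := monomial (letters u))) i = monomial u'"
        if "j \<le> i" "i < N" for i
        using Suc.prems(2)[of j] Suc.prems(3)[of i] that \<open>u \<in> Poly_Mapping.keys (v j)\<close>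
        by (cases "i = j") (auto simp: graded_def)
      show "(v(j := monomial (letters u))) i = letter i" if "N \<le> i" for i
        using Suc.prems(1,4) that by auto
    qed
    moreover have "list_all (\<lambda>(k, w). distinct w \<and> j \<in> set w) L"
      by (rule list.pred_mono_strong[OF L]) (use Suc.prems(1) in auto)
    ultimately have "rat.combination (\<lambda>w. form n T (prod_list (map (v(j := \<Sum>u\<in>Poly_Mapping.keys (v j).
        word_scale (Poly_Mapping.lookup (v j) u) (monomial (letters u)))) w))) L = 0"
      by (simp only: combination_form_fun_upd_sum sum.neutral mult_zero_right)
        (simp add: sum.neutral)
    \<comment> \<open>By \<open>word_expansion\<close> the substituted sum is \<open>v j\<close>
      itself, so the update changes nothing.\<close>
    then show ?case
      by (simp only: word_expansion[of "v j", symmetric] fun_upd_triv)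
  qed
  from this[of N v] show ?thesis using v by auto
qed

section \<open>Matching words with table entries block by block\<close>

primrec pieces :: "(nat \<Rightarrow> nat) \<Rightarrow> nat list \<Rightarrow> nat list \<Rightarrow> (nat \<times> nat list) list" where
  "pieces len [] e = []"
| "pieces len (i # w) e = (i, take (len i) e) # pieces len w (drop (len i) e)"

lemma pieces:
  assumes "distinct w" "length e = (\<Sum>i\<leftarrow>w. len i)"
  defines "g \<equiv> \<lambda>i. the (map_of (pieces len w e) i)"
  shows "concat (map g w) = e" "\<And>i. i \<in> set w \<Longrightarrow> length (g i) = len i"
    "\<And>i. i \<in> set w \<Longrightarrow> map_of (pieces len w e) i = Some (g i)"
proof -
  have "concat (map (\<lambda>i. the (map_of (pieces len w e) i)) w) = e \<and>
      (\<forall>i\<in>set w. length (the (map_of (pieces len w e) i)) = len i \<and> map_of (pieces len w e) i \<noteq> None)"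
    using assms(1,2)
  proof (induction w arbitrary: e)
    case (Cons j w)
    have "concat (map (\<lambda>i. the (map_of (pieces len (j # w) e) i)) (j # w)) =
        take (len j) e @ concat (map (\<lambda>i. the (map_of (pieces len w (drop (len j) e)) i)) w)"
      using Cons.prems(1) by (auto intro!: arg_cong[where f = concat] map_cong)
    then show ?case
      unfolding \<open>concat _ = _\<close> using Cons.IH[of "drop (len j) e"] Cons.prems by auto
  qed simp
  then show "concat (map g w) = e" "\<And>i. i \<in> set w \<Longrightarrow> length (g i) = len i"
    "\<And>i. i \<in> set w \<Longrightarrow> map_of (pieces len w e) i = Some (g i)"
    unfolding g_def by auto
qed

lemma concat_map_eq_iff:
  assumes "\<And>i. i \<in> set w \<Longrightarrow> length (f i) = length (g i)"
  shows "concat (map f w) = concat (map g w) \<longleftrightarrow> (\<forall>i\<in>set w. f i = g i)"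
  using assms by (induction w) auto

text \<open>If the arguments \<open>ws i\<close> have lengths \<open>len i\<close>, then the word obtained from them in the order \<open>w\<close>
  agrees with \<open>e\<close> up to a renaming of the labels iff \<open>ws 0 @ \<dots> @ ws 6\<close> agrees with the rearrangement
  of \<open>e\<close> up to the same renaming.  An identity in seven arguments thus becomes a cancellation in a
  list of words which does not depend on the arguments.\<close>

definition assemble :: "(nat \<times> nat list) list \<Rightarrow> nat list list" where
  "assemble Z = (if list_all (\<lambda>i. map_of Z i = Some [i]) [7, 8, 9]
    then [concat (map (\<lambda>i. the (map_of Z i)) [0..<7])] else [])"

text \<open>Implied by the test in \<open>assemble\<close>, but cheaper because it fails early.\<close>

fun fits :: "(nat \<Rightarrow> nat) \<Rightarrow> nat list \<Rightarrow> nat list \<Rightarrow> bool" where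
  "fits len [] e \<longleftrightarrow> True"
| "fits len (i # w) e \<longleftrightarrow> (if i < 7 then fits len w (drop (len i) e)
    else (case e of [] \<Rightarrow> False | x # e' \<Rightarrow> x = i \<and> fits len w e'))"

lemma fitsI:
  assumes "distinct w" "\<And>i. i \<in> set w \<Longrightarrow> 7 \<le> i \<Longrightarrow> len i = 1 \<and> map_of (pieces len w e) i = Some [i]"
  shows "fits len w e"
  using assms
proof (induction w arbitrary: e)
  case (Cons j w)
  have IH: "fits len w (drop (len j) e)"
  proof (rule Cons.IH)
    show "distinct w" using Cons.prems(1) by simp
    show "len i = 1 \<and> map_of (pieces len w (drop (len j) e)) i = Some [i]"
      if "i \<in> set w" "7 \<le> i" for i
      using Cons.prems(1) Cons.prems(2)[of i] that by (auto split: if_splits)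
  qed
  show ?case
  proof (cases "j < 7")
    case False
    then have "len j = 1" "take 1 e = [j]" using Cons.prems(2)[of j] by auto
    then show ?thesis using IH False by (cases e) auto
  qed (use IH in simp)
qed simp

definition rearrange :: "(nat \<Rightarrow> nat) \<Rightarrow> nat list \<Rightarrow> nat list \<Rightarrow> nat list list" where
  "rearrange len w e = (if fits len w e then assemble (pieces len w e) else [])"

fun rearrange_with :: "(nat \<Rightarrow> nat) \<Rightarrow> int \<Rightarrow> nat list \<Rightarrow> (int \<times> nat list) list \<Rightarrow> (int \<times> nat list) list" where
  "rearrange_with len k w [] = []"
| "rearrange_with len k w ((c, e) # T) = map (Pair (k * c)) (rearrange len w e) @ rearrange_with len k w T"

fun rearranged_terms ::
    "(nat \<Rightarrow> nat) \<Rightarrow> (int \<times> nat list) list \<Rightarrow> (int \<times> nat list) list \<Rightarrow> (int \<times> nat list) list" where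
  "rearranged_terms len [] T = []"
| "rearranged_terms len ((k, w) # L) T = rearrange_with len k w T @ rearranged_terms len L T"

lemma (in rat_vector_space) combination_rearranged_terms:
  "combination h (rearranged_terms len L T) =
    combination (\<lambda>w. combination (\<lambda>e. \<Sum>u\<leftarrow>rearrange len w e. h u) T) L"
proof -
  have inner: "combination h (rearrange_with len k w T) =
      scale (of_int k) (combination (\<lambda>e. \<Sum>u\<leftarrow>rearrange len w e. h u) T)" for k w
    by (induction T) (auto simp: scale_right_distrib scale_sum_list o_def)
  show ?thesis
    by (induction L) (auto simp: inner)
qed

lemma alternation_concat_eq:
  assumes w: "distinct w" "set w = {..<10}" and e: "length e = (\<Sum>i\<leftarrow>w. len i)"
    and ws: "\<And>i. i < 10 \<Longrightarrow> length (ws i) = len i" "\<And>i. 7 \<le> i \<Longrightarrow> ws i = [i]"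
    and n: "n \<le> 6"
  shows "rat.alternation n (\<lambda>u. of_bool (concat (map ws w) = u)) e =
    (\<Sum>u\<leftarrow>rearrange len w e. rat.alternation n (\<lambda>u. of_bool (concat (map ws [0..<7]) = u)) u)"
proof -
  define Z where "Z = pieces len w e"
  define g where "g = (\<lambda>i. the (map_of Z i))"
  have Z: "concat (map g w) = e" "\<And>i. i \<in> set w \<Longrightarrow> length (g i) = len i"
    "\<And>i. i \<in> set w \<Longrightarrow> map_of Z i = Some (g i)"
    using pieces[OF w(1) e] by (simp_all add: Z_def g_def)
  have eq: "concat (map ws w) = map \<sigma> e \<longleftrightarrow>
      list_all (\<lambda>i. map_of Z i = Some [i]) [7, 8, 9] \<and>
      concat (map ws [0..<7]) = map \<sigma> (concat (map g [0..<7]))"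
    if "\<sigma> permutes {1..n}" for \<sigma>
  proof -
    \<comment> \<open>Since \<open>n \<le> 6\<close>, \<sigma> fixes the separators. Their blocks
      give a condition on \<open>e\<close> alone, which decides whether \<open>rearrange\<close>
      returns a word or nothing.\<close>
    have fixed: "map \<sigma> x = [i] \<longleftrightarrow> x = [i]" if "7 \<le> i" for i x
    proof -
      have "\<sigma> i = i" using \<open>\<sigma> permutes {1..n}\<close> n that by (auto simp: permutes_def)
      then have "map \<sigma> x = [i] \<longleftrightarrow> map \<sigma> x = map \<sigma> [i]" by simp
      also have "\<dots> \<longleftrightarrow> x = [i]"
        using \<open>\<sigma> permutes {1..n}\<close> by (intro inj_map_eq_map permutes_inj)
      finally show ?thesis .
    qed
    have map_g: "map \<sigma> (concat (map g xs)) = concat (map (\<lambda>i. map \<sigma> (g i)) xs)" for xs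
      by (simp add: map_concat o_def)
    have "concat (map ws w) = map \<sigma> e \<longleftrightarrow> concat (map ws w) = concat (map (\<lambda>i. map \<sigma> (g i)) w)"
      by (simp add: Z(1) flip: map_g)
    also have "\<dots> \<longleftrightarrow> (\<forall>i\<in>set w. ws i = map \<sigma> (g i))"
      using Z(2) ws(1) w(2) by (intro concat_map_eq_iff) auto
    finally have w_iff: "concat (map ws w) = map \<sigma> e \<longleftrightarrow> (\<forall>i\<in>set w. ws i = map \<sigma> (g i))" .
    have sep: "ws i = map \<sigma> (g i) \<longleftrightarrow> g i = [i]" if "i \<in> {7, 8, 9}" for i
      using ws(2)[of i] fixed[of i "g i"] that by (auto dest: sym)
    have set_w: "set w = set [0..<7] \<union> {7, 8, 9}"
      unfolding w(2) set_upt by (intro set_eqI) (simp, presburger)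
    have "concat (map ws w) = map \<sigma> e \<longleftrightarrow>
        (\<forall>i\<in>{7, 8, 9}. g i = [i]) \<and> (\<forall>i\<in>set [0..<7]. ws i = map \<sigma> (g i))"
      unfolding w_iff set_w ball_Un using sep by blast
    also have "(\<forall>i\<in>set [0..<7]. ws i = map \<sigma> (g i)) \<longleftrightarrow>
        concat (map ws [0..<7]) = concat (map (\<lambda>i. map \<sigma> (g i)) [0..<7])"
      using Z(2) ws(1) w(2) by (intro concat_map_eq_iff[symmetric]) auto
    also have "(\<forall>i\<in>{7, 8, 9}. g i = [i]) \<longleftrightarrow> list_all (\<lambda>i. map_of Z i = Some [i]) [7, 8, 9]"
      using Z(3) w(2) by auto
    finally show ?thesis by (simp only: map_g)
  qed
  show ?thesis
  proof (cases "list_all (\<lambda>i. map_of Z i = Some [i]) [7, 8, 9]")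
    case True
    have "fits len w e"
    proof (rule fitsI[OF w(1)])
      fix i assume i: "i \<in> set w" "7 \<le> i"
      then have "i < 10" using w(2) by simp
      then have "i = 7 \<or> i = 8 \<or> i = 9" using i(2) by presburger
      then have "map_of Z i = Some [i]" using True by auto
      moreover have "len i = 1"
        using ws(1)[OF \<open>i < 10\<close>] ws(2)[OF i(2)] by simp
      ultimately show "len i = 1 \<and> map_of (pieces len w e) i = Some [i]"
        by (simp add: Z_def)
    qed
    then have "rearrange len w e = [concat (map g [0..<7])]"
      using True by (simp add: rearrange_def assemble_def g_def flip: Z_def)
    then show ?thesis
      using True eq by (simp add: rat.alternation_def)
  next
    case False
    then have "rearrange len w e = []"
      by (auto simp: rearrange_def assemble_def simp flip: Z_def)
    moreover have "rat.alternation n (\<lambda>u. of_bool (concat (map ws w) = u)) e = 0"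
      unfolding rat.alternation_def using False eq by (intro sum.neutral) auto
    ultimately show ?thesis by simp
  qed
qed

text \<open>The entries of \<open>T\<close> have ten letters besides the separators, and seven lengths that are 1 modulo 3
  add up to 10 only as \<open>4 + 1 + \<dots> + 1\<close>.\<close>

lemma combination_form_words:
  assumes L: "list_all (\<lambda>(k, w). distinct w \<and> set w = {..<10}) L"
    and T: "list_all (\<lambda>(c, e). length e = 13) T" and n: "n \<le> 6"
    and checks: "\<And>pos. pos < 7 \<Longrightarrow>
      list_all (\<lambda>(k, w). labels_ok n w) (rearranged_terms (\<lambda>i. if i = pos then 4 else 1) L T) \<and>
      cancels (map sort_term (rearranged_terms (\<lambda>i. if i = pos then 4 else 1) L T))"
    and ws: "\<And>i. i < 7 \<Longrightarrow> length (ws i) mod 3 = 1" "\<And>i. 7 \<le> i \<Longrightarrow> ws i = [i]"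
  shows "rat.combination (\<lambda>w. form n T (monomial (concat (map ws w)))) L = 0"
proof -
  have length: "length (concat (map f w)) = (\<Sum>i<10. length (f i))"
    if "(k, w) \<in> set L" for k w and f :: "nat \<Rightarrow> nat list"
    using L that by (auto simp: list_all_iff length_concat o_def sum.distinct_set_conv_list[symmetric])
  show ?thesis
  proof (cases "(\<Sum>i<7. length (ws i)) = 10")
    \<comment> \<open>Entries of \<open>T\<close> have 13 letters, the three separators included, so
      a word of any other length meets none of them.\<close>
    case False
    have "length (concat (map ws w)) \<noteq> 13" if "(k, w) \<in> set L" for k w
      using False length[OF that, of ws] ws(2) by (simp add: numeral_eq_Suc)
    then have "rat.alternation n (\<lambda>u. of_bool (concat (map ws w) = u)) e = 0"
      if "(k, w) \<in> set L" "(c, e) \<in> set T" for k w c e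
      using T that unfolding rat.alternation_def
      by (intro sum.neutral) (force simp: list_all_iff dest: arg_cong[where f = length])
    then show ?thesis
      unfolding form_monomial by (auto intro!: rat.combination_neutral)
  next
    case True
    have pos: "1 \<le> length (ws i)" if "i < 7" for i
      using ws(1)[OF that] by (cases "ws i") auto
    have "\<exists>pos<7. \<forall>i<7. length (ws i) = (if i = pos then 4 else 1)"
    proof -
      have "\<exists>pos<7. length (ws pos) \<noteq> 1"
      proof (rule ccontr)
        assume "\<not> ?thesis"
        then have "(\<Sum>i<7. length (ws i)) = (\<Sum>i<(7::nat). 1)" by (intro sum.cong) auto
        with True show False by simp
      qed
      then obtain p where p: "p < 7" "length (ws p) \<noteq> 1" by auto
      then have "4 \<le> length (ws p)" using ws(1)[OF p(1)] by presburger
      have rest: "(\<Sum>i<7. length (ws i)) = length (ws p) + (\<Sum>i\<in>{..<7}-{p}. length (ws i))"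
        using p(1) by (intro sum.remove) auto
      \<comment> \<open>Each of the six other lengths is written as 1 plus an excess: 4 and six ones
        already make 10, so these excesses vanish.\<close>
      have "(\<Sum>i\<in>{..<7}-{p}. length (ws i)) = (\<Sum>i\<in>{..<7}-{p}. 1 + (length (ws i) - 1))"
        by (intro sum.cong refl) (metis DiffE lessThan_iff le_add_diff_inverse pos)
      also have "\<dots> = 6 + (\<Sum>i\<in>{..<7}-{p}. length (ws i) - 1)"
        unfolding sum.distrib using p(1) by simp
      finally have "length (ws p) = 4" "(\<Sum>i\<in>{..<7}-{p}. length (ws i) - 1) = 0"
        using rest True \<open>4 \<le> length (ws p)\<close> by linarith+
      then have "\<forall>i<7. length (ws i) = (if i = p then 4 else 1)"
        using pos by (fastforce intro: le_antisym)
      with p(1) show ?thesis by blast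
    qed
    then obtain p where p: "p < 7" "\<And>i. i < 7 \<Longrightarrow> length (ws i) = (if i = p then 4 else 1)"
      by blast
    define len where "len = (\<lambda>i. if i = p then 4 else 1 :: nat)"
    have len: "length (ws i) = len i" if "i < 10" for i
      using p ws(2)[of i] that by (cases "i < 7") (auto simp: len_def)
    have "rat.combination (\<lambda>w. form n T (monomial (concat (map ws w)))) L =
        rat.combination (rat.alternation n (\<lambda>u. of_bool (concat (map ws [0..<7]) = u)))
          (rearranged_terms len L T)"
    proof -
      have "form n T (monomial (concat (map ws w))) =
          rat.combination (\<lambda>e. \<Sum>u\<leftarrow>rearrange len w e.
            rat.alternation n (\<lambda>u. of_bool (concat (map ws [0..<7]) = u)) u) T"
        if "(k, w) \<in> set L" for k w
        unfolding form_monomial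
      proof (intro rat.combination_cong ballI, clarify)
        fix c e assume "(c, e) \<in> set T"
        have "length (concat (map ws w)) = 13"
          using True length[OF that, of ws] ws(2) by (simp add: numeral_eq_Suc)
        moreover have "map (length \<circ> ws) w = map len w"
          using L that len by (auto simp: list_all_iff)
        ultimately have "length e = (\<Sum>i\<leftarrow>w. len i)"
          using T \<open>(c, e) \<in> set T\<close> by (auto simp: list_all_iff length_concat)
        then show "rat.alternation n (\<lambda>u. of_bool (concat (map ws w) = u)) e =
          (\<Sum>u\<leftarrow>rearrange len w e. rat.alternation n (\<lambda>u. of_bool (concat (map ws [0..<7]) = u)) u)"
          using L that len ws(2) n by (intro alternation_concat_eq) (auto simp: list_all_iff)
      qed
      then have "rat.combination (\<lambda>w. form n T (monomial (concat (map ws w)))) L =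
          rat.combination (\<lambda>w. rat.combination (\<lambda>e. \<Sum>u\<leftarrow>rearrange len w e.
            rat.alternation n (\<lambda>u. of_bool (concat (map ws [0..<7]) = u)) u) T) L"
        by (intro rat.combination_cong) auto
      also have "\<dots> = rat.combination (rat.alternation n (\<lambda>u. of_bool (concat (map ws [0..<7]) = u)))
          (rearranged_terms len L T)"
        by (rule rat.combination_rearranged_terms[symmetric])
      finally show ?thesis .
    qed
    \<comment> \<open>The remaining list of signed words depends on the position \<open>p\<close>
      only, not on \<open>ws\<close>, so it is covered by one of seven finite checks.\<close>
    also have "\<dots> = 0"
      unfolding len_def rat.combination_sort_term[OF rat.antisymmetric_alternation n conjunct1[OF checks[OF p(1)]]]
      by (rule rat.combination_cancels[OF conjunct2[OF checks[OF p(1)]]])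
    finally show ?thesis .
  qed
qed

section \<open>The twisted operation is a Jordan quadruple system\<close>

definition identity_i_terms :: "(int \<times> nat quad_monomial) list" where
  "identity_i_terms = (let a = Var 0; b = Var 1; c = Var 2; d = Var 3; e = Var 4; f = Var 5; g = Var 6 in [
      (1, \<langle>\<langle>a, b, c, d\<rangle>, e, f, g\<rangle>), (1, \<langle>\<langle>a, b, f, e\<rangle>, d, c, g\<rangle>),
      (1, \<langle>\<langle>d, c, f, e\<rangle>, a, b, g\<rangle>), (-1, \<langle>g, \<langle>b, a, d, c\<rangle>, f, e\<rangle>),
      (-1, \<langle>g, \<langle>b, a, e, f\<rangle>, c, d\<rangle>), (-1, \<langle>g, \<langle>c, d, e, f\<rangle>, b, a\<rangle>)])"

definition identity_ii_terms :: "(int \<times> nat quad_monomial) list" where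
  "identity_ii_terms = (let a = Var 0; b = Var 1; c = Var 2; d = Var 3; e = Var 4; f = Var 5; g = Var 6 in [
      (1, \<langle>\<langle>a, b, c, d\<rangle>, e, f, g\<rangle>), (-1, \<langle>\<langle>a, b, g, f\<rangle>, e, c, d\<rangle>),
      (1, \<langle>\<langle>a, b, d, c\<rangle>, e, g, f\<rangle>), (-1, \<langle>\<langle>a, b, f, g\<rangle>, e, d, c\<rangle>),
      (1, \<langle>\<langle>a, e, c, d\<rangle>, b, g, f\<rangle>), (-1, \<langle>\<langle>a, e, g, f\<rangle>, b, d, c\<rangle>),
      (1, \<langle>\<langle>a, e, d, c\<rangle>, b, f, g\<rangle>), (-1, \<langle>\<langle>a, e, f, g\<rangle>, b, c, d\<rangle>),
      (-1, \<langle>a, \<langle>b, c, d, e\<rangle>, f, g\<rangle>), (1, \<langle>a, \<langle>b, g, f, e\<rangle>, c, d\<rangle>),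
      (-1, \<langle>a, \<langle>b, d, c, e\<rangle>, g, f\<rangle>), (1, \<langle>a, \<langle>b, f, g, e\<rangle>, d, c\<rangle>)])"

definition identity_iii_terms :: "(int \<times> nat quad_monomial) list" where
  "identity_iii_terms = (let a = Var 0; b = Var 1; c = Var 2; d = Var 3; e = Var 4; f = Var 5; g = Var 6 in [
      (1, \<langle>\<langle>a, b, c, d\<rangle>, e, f, g\<rangle>), (-1, \<langle>\<langle>a, f, g, c\<rangle>, b, e, d\<rangle>),
      (1, \<langle>\<langle>c, b, a, d\<rangle>, e, g, f\<rangle>), (1, \<langle>\<langle>f, b, c, e\<rangle>, g, a, d\<rangle>),
      (-1, \<langle>\<langle>f, g, a, e\<rangle>, c, b, d\<rangle>), (-1, \<langle>\<langle>f, g, a, d\<rangle>, b, c, e\<rangle>),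
      (-1, \<langle>\<langle>f, g, e, d\<rangle>, a, b, c\<rangle>), (1, \<langle>\<langle>g, b, a, e\<rangle>, f, c, d\<rangle>),
      (-1, \<langle>\<langle>g, f, c, e\<rangle>, a, b, d\<rangle>), (-1, \<langle>\<langle>g, f, c, d\<rangle>, b, a, e\<rangle>),
      (-1, \<langle>\<langle>g, f, e, d\<rangle>, c, b, a\<rangle>), (1, \<langle>\<langle>e, a, b, d\<rangle>, c, f, g\<rangle>),
      (1, \<langle>\<langle>e, c, b, d\<rangle>, a, g, f\<rangle>), (1, \<langle>a, \<langle>b, c, g, f\<rangle>, e, d\<rangle>),
      (1, \<langle>c, \<langle>b, a, f, g\<rangle>, e, d\<rangle>), (-1, \<langle>f, \<langle>b, c, e, g\<rangle>, a, d\<rangle>),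
      (-1, \<langle>g, \<langle>b, a, e, f\<rangle>, c, d\<rangle>), (1, \<langle>e, \<langle>a, g, f, c\<rangle>, b, d\<rangle>)])"

fun is_Quad :: "'x quad_monomial \<Rightarrow> bool" where
  "is_Quad (Var x) = False"
| "is_Quad \<langle>p, q, r, s\<rangle> = True"

lemma is_Quad_iff: "is_Quad m \<longleftrightarrow> (\<exists>p q r s. m = \<langle>p, q, r, s\<rangle>)"
  by (cases m) auto

text \<open>The defining identities are multilinear and hold for the tetrad word by word, so nothing
  is sorted before \<open>cancels\<close>. The last clause provides the single occurrences that
  multilinear expansion requires. No table enters, so both systems share the computation.\<close>

definition tetrad_check :: "(int \<times> nat quad_monomial) list \<Rightarrow> bool" where
  "tetrad_check ts \<longleftrightarrow> list_all (\<lambda>(k, m). is_Quad m) ts \<and> cancels (expand words ts) \<and>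
    list_all (\<lambda>(k, w). distinct w \<and> set w = {..<10}) (expand separated_words ts)"

definition sorted_cancels :: "nat \<Rightarrow> (int \<times> nat list) list \<Rightarrow> bool" where
  "sorted_cancels n L \<longleftrightarrow> list_all (\<lambda>(k, w). labels_ok n w) L \<and> cancels (map sort_term L)"

text \<open>A constant of its own: \<open>code_simp\<close> would otherwise evaluate the check below the binder
  for \<open>pos\<close>.\<close>

definition form_check_at :: "nat \<Rightarrow> (int \<times> nat list) list \<Rightarrow> (int \<times> nat list) list \<Rightarrow> nat \<Rightarrow> bool" where
  "form_check_at n T L pos \<longleftrightarrow> sorted_cancels n (rearranged_terms (\<lambda>i. if i = pos then 4 else 1) L T)"

definition form_check :: "nat \<Rightarrow> (int \<times> nat list) list \<Rightarrow> (int \<times> nat list) list \<Rightarrow> bool" where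
  "form_check n T L \<longleftrightarrow> list_all (form_check_at n T L) [0..<7]"

lemma linearI:
  assumes "\<And>x y. f (x + y) = f x + f y" "\<And>r x. f (word_scale r x) = word_scale r (f x)"
  shows "Vector_Spaces.linear word_scale word_scale f"
  using assms word.vector_space_axioms
  by (simp add: Vector_Spaces.linear_def module_hom_def module_hom_axioms_def module_iff_vector_space)

lemma single_zero_scale:
  "Poly_Mapping.single 0 (r * c) = word_scale r (Poly_Mapping.single 0 c)"
  by (simp add: word_scale_def mult_single)

lemma twisted_quad_combination_eq_0:
  assumes n: "n \<le> 6" and T: "list_all (\<lambda>(c, e). length e = 13) T"
    and ts: "tetrad_check ts" "form_check n T (expand separated_words ts)"
    and v: "\<And>i. 7 \<le> i \<Longrightarrow> v i = letter i"
  shows "word.combination (eval_monomial (twisted_quad n T) v) ts = 0"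
proof -
  have proj_v: "(proj \<circ> v) i = letter i" if "7 \<le> i" for i
    using v[OF that] by (simp add: proj_graded graded_def)
  have "word.combination (eval_monomial tetrad (proj \<circ> v)) ts = 0"
    using ts(1) word.combination_cancels[of "expand words ts" "\<lambda>w. list_prod (map (proj \<circ> v) w)"]
    unfolding eval_tetrad word.combination_expand by (simp add: tetrad_check_def)
  moreover have "rat.combination (\<lambda>w. form n T (prod_list (map (proj \<circ> v) w))) (expand separated_words ts) = 0"
  proof (rule combination_form_eq_0[where N = 7])
    show "list_all (\<lambda>(k, w). distinct w \<and> {..<7} \<subseteq> set w) (expand separated_words ts)"
    proof (rule list.pred_mono_strong)
      show "list_all (\<lambda>(k, w). distinct w \<and> set w = {..<10}) (expand separated_words ts)"
        using ts(1) by (simp add: tetrad_check_def)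
    qed (clarify, simp)
    show "graded 1 ((proj \<circ> v) i)" for i by (simp only: comp_apply graded_proj)
    show "(proj \<circ> v) i = letter i" if "7 \<le> i" for i by (rule proj_v[OF that])
    show "rat.combination (\<lambda>w. form n T (monomial (concat (map ws w)))) (expand separated_words ts) = 0"
      if "\<And>i. i < 7 \<Longrightarrow> length (ws i) mod 3 = 1" "\<And>i. 7 \<le> i \<Longrightarrow> ws i = [i]" for ws
    proof (rule combination_form_words[OF _ T n _ that])
      show "list_all (\<lambda>(k, w). distinct w \<and> set w = {..<10}) (expand separated_words ts)"
        using ts(1) by (simp add: tetrad_check_def)
      fix pos :: nat assume "pos < 7"
      then have "form_check_at n T (expand separated_words ts) pos"
        using ts(2) by (simp add: form_check_def list_all_iff)
      then show "list_all (\<lambda>(k, w). labels_ok n w)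
          (rearranged_terms (\<lambda>i. if i = pos then 4 else 1) (expand separated_words ts) T) \<and>
        cancels (map sort_term (rearranged_terms (\<lambda>i. if i = pos then 4 else 1) (expand separated_words ts) T))"
        by (simp add: form_check_at_def sorted_cancels_def)
    qed
  qed
  moreover have "list_all (\<lambda>(k, m). \<exists>p q r s. m = \<langle>p, q, r, s\<rangle>) ts"
    using ts(1) by (simp add: tetrad_check_def is_Quad_iff)
  ultimately show ?thesis
    using v by (subst combination_twisted_quad) auto
qed

lemma jordan_quadruple_system_twisted_quad:
  assumes n: "n \<le> 6" and T: "list_all (\<lambda>(c, e). length e = 13) T"
    and tetrad: "tetrad_check identity_i_terms" "tetrad_check identity_ii_terms"
      "tetrad_check identity_iii_terms"
    and form: "form_check n T (expand separated_words identity_i_terms)"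
      "form_check n T (expand separated_words identity_ii_terms)"
      "form_check n T (expand separated_words identity_iii_terms)"
  shows "jordan_quadruple_system word_scale (twisted_quad n T)"
proof (intro jordan_quadruple_system.intro jordan_quadruple_system_axioms.intro word.vector_space_axioms)
  note add = twisted_quad_def tetrad_def border_def proj_add form_add single_add distrib_left distrib_right add_ac
  note scale = twisted_quad_def tetrad_def border_def proj_scale word.scale_mult_left
    word.scale_mult_right word.scale_right_distrib[symmetric] form_scale single_zero_scale
  show "Vector_Spaces.linear word_scale word_scale (\<lambda>a. twisted_quad n T a b c d)" for b c d
    by (rule linearI, simp only: add, simp only: scale)
  show "Vector_Spaces.linear word_scale word_scale (\<lambda>b. twisted_quad n T a b c d)" for a c d
    by (rule linearI, simp only: add, simp only: scale)
  show "Vector_Spaces.linear word_scale word_scale (\<lambda>c. twisted_quad n T a b c d)" for a b d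
    by (rule linearI, simp only: add, simp only: scale)
  show "Vector_Spaces.linear word_scale word_scale (\<lambda>d. twisted_quad n T a b c d)" for a b c
    by (rule linearI, simp only: add, simp only: scale)
  show "twisted_quad n T a b c d = twisted_quad n T d c b a" for a b c d
    by (simp add: twisted_quad_def tetrad_def border_def add.commute)
  fix a b c d e f g
  \<comment> \<open>The variables 0 to 6 take the seven arguments; from 7 on, the separators keep
    their letters.\<close>
  define v where "v = (\<lambda>i. if i < 7 then [a, b, c, d, e, f, g] ! i else letter i)"
  have v: "v 0 = a" "v 1 = b" "v 2 = c" "v 3 = d" "v 4 = e" "v 5 = f" "v 6 = g"
    "\<And>i. 7 \<le> i \<Longrightarrow> v i = letter i"
    by (simp_all add: v_def)
  let ?Q = "twisted_quad n T"
  note * = twisted_quad_combination_eq_0[OF n T _ _ v(8)]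
  show "?Q (?Q a b c d) e f g + ?Q (?Q a b f e) d c g
       + ?Q (?Q d c f e) a b g - ?Q g (?Q b a d c) f e
       - ?Q g (?Q b a e f) c d - ?Q g (?Q c d e f) b a = 0"
    using *[OF tetrad(1) form(1)] by (simp add: identity_i_terms_def Let_def v(1-7)[simplified] algebra_simps)
  show "?Q (?Q a b c d) e f g - ?Q (?Q a b g f) e c d
       + ?Q (?Q a b d c) e g f - ?Q (?Q a b f g) e d c
       + ?Q (?Q a e c d) b g f - ?Q (?Q a e g f) b d c
       + ?Q (?Q a e d c) b f g - ?Q (?Q a e f g) b c d
       - ?Q a (?Q b c d e) f g + ?Q a (?Q b g f e) c d
       - ?Q a (?Q b d c e) g f + ?Q a (?Q b f g e) d c = 0"
    using *[OF tetrad(2) form(2)] by (simp add: identity_ii_terms_def Let_def v(1-7)[simplified] algebra_simps)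
  show "?Q (?Q a b c d) e f g - ?Q (?Q a f g c) b e d
       + ?Q (?Q c b a d) e g f + ?Q (?Q f b c e) g a d
       - ?Q (?Q f g a e) c b d - ?Q (?Q f g a d) b c e
       - ?Q (?Q f g e d) a b c + ?Q (?Q g b a e) f c d
       - ?Q (?Q g f c e) a b d - ?Q (?Q g f c d) b a e
       - ?Q (?Q g f e d) c b a + ?Q (?Q e a b d) c f g
       + ?Q (?Q e c b d) a g f + ?Q a (?Q b c g f) e d
       + ?Q c (?Q b a f g) e d - ?Q f (?Q b c e g) a d
       - ?Q g (?Q b a e f) c d + ?Q e (?Q a g f c) b d = 0"
    using *[OF tetrad(3) form(3)] by (simp add: identity_iii_terms_def Let_def v(1-7)[simplified] algebra_simps)
qed

section \<open>Detecting an identity\<close>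

lemma form_monomial_permute:
  assumes q: "q permutes {1..n}"
  shows "form n T (monomial (map q u)) = of_int (sign q) * form n T (monomial u)"
proof -
  have "rat.alternation n (\<lambda>u'. of_bool (map q u = u')) e =
      of_int (sign q) * rat.alternation n (\<lambda>u'. of_bool (u = u')) e" for e
  proof -
    have "rat.alternation n (\<lambda>u'. of_bool (map q u = u')) e =
        (\<Sum>\<sigma> | \<sigma> permutes {1..n}. of_int (sign (q \<circ> \<sigma>)) * of_bool (map q u = map (q \<circ> \<sigma>) e))"
      unfolding rat.alternation_def by (rule setum_permutations_compose_left[OF q])
    also have "\<dots> = (\<Sum>\<sigma> | \<sigma> permutes {1..n}. of_int (sign q) * (of_int (sign \<sigma>) * of_bool (u = map \<sigma> e)))"
    proof (intro sum.cong refl)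
      fix \<sigma> assume "\<sigma> \<in> {\<sigma>. \<sigma> permutes {1..n}}"
      then have "permutation \<sigma>" "permutation q"
        using q by (auto intro: permutation_permutes[THEN iffD2])
      then have "sign (q \<circ> \<sigma>) = sign q * sign \<sigma>" by (rule sign_compose[rotated])
      moreover have "map q u = map (q \<circ> \<sigma>) e \<longleftrightarrow> u = map \<sigma> e"
        using inj_map_eq_map[OF permutes_inj[OF q], of u "map \<sigma> e"] by simp
      ultimately show "of_int (sign (q \<circ> \<sigma>)) * of_bool (map q u = map (q \<circ> \<sigma>) e) =
        of_int (sign q) * (of_int (sign \<sigma>) * (of_bool (u = map \<sigma> e) :: rat))" by simp
    qed
    finally show ?thesis by (simp add: rat.alternation_def sum_distrib_left)
  qed
  then show ?thesis
    unfolding form_monomial by (induction T) (auto simp: distrib_left mult.left_commute)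
qed

lemma antisymmetric_form_monomial: "rat.antisymmetric n (\<lambda>u. form n T (monomial u))"
  unfolding rat.antisymmetric_def
proof safe
  fix i j u assume "i \<in> {1..n}" "j \<in> {1..n}" "i \<noteq> j"
  then show "form n T (monomial (map (transpose i j) u)) = - form n T (monomial u)"
    by (subst form_monomial_permute[OF permutes_swap_id]) (auto simp: sign_swap_id)
qed

text \<open>A renaming that carries one word with the labels 1, ..., n in order to another such word
  is the identity. So at most \<open>e\<close> itself contributes from its orbit, and evaluating the
  form is a table lookup.\<close>

lemma form_monomial_sorted:
  assumes n: "n \<le> 6" and u: "filter is_label u = [1..<Suc n]"
    and T: "list_all (\<lambda>(c, e). filter is_label e = [1..<Suc n]) T"
  shows "form n T (monomial u) = rat.combination (\<lambda>e. of_bool (u = e)) T"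
  unfolding form_monomial
proof (intro rat.combination_cong ballI, clarify)
  fix c e assume "(c, e) \<in> set T"
  then have e: "filter is_label e = [1..<Suc n]" using T by (auto simp: list_all_iff)
  have "u = map \<sigma> e \<longleftrightarrow> \<sigma> = id \<and> u = e" if \<sigma>: "\<sigma> permutes {1..n}" for \<sigma>
  proof
    assume eq: "u = map \<sigma> e"
    have label: "is_label (\<sigma> x) \<longleftrightarrow> is_label x" for x
      using permutes_in_image[OF \<sigma>, of x] \<sigma> n by (cases "x \<in> {1..n}") (auto simp: permutes_def)
    have "map \<sigma> (filter is_label e) = filter is_label u"
      unfolding eq filter_map by (simp add: o_def label)
    then have "map \<sigma> [1..<Suc n] = map id [1..<Suc n]" by (simp only: e u list.map_id)
    then have "\<sigma> x = x" if "x \<in> {1..n}" for x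
      using that by (simp only: map_eq_conv) (auto simp del: upt_Suc)
    then have "\<sigma> = id" using \<sigma> by (auto simp: permutes_def fun_eq_iff)
    with eq show "\<sigma> = id \<and> u = e" by simp
  qed auto
  then have "rat.alternation n (\<lambda>u'. of_bool (u = u')) e =
      (\<Sum>\<sigma> | \<sigma> permutes {1..n}. if \<sigma> = id then of_bool (u = e) else 0)"
    unfolding rat.alternation_def by (intro sum.cong) auto
  also have "\<dots> = of_bool (u = e)"
    by (simp add: finite_permutations permutes_id)
  finally show "rat.alternation n (\<lambda>u'. of_bool (u = u')) e = of_bool (u = e)" .
qed

text \<open>This is a decomposition into cosets of the stabilizer of \<open>Suc m\<close>. The
  transposition must stand on the right, next to the word, leaving \<open>q\<close> outside where
  the form is alternating; passing to inverses and back moves it there.\<close>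

lemma sum_permutations_Suc:
  "(\<Sum>\<sigma> | \<sigma> permutes {1..Suc m}. f \<sigma>) =
    (\<Sum>b\<in>{1..Suc m}. \<Sum>q | q permutes {1..m}. f (q \<circ> transpose (Suc m) b))"
proof -
  have ins: "{1..Suc m} = insert (Suc m) {1..m}" by auto
  have "(\<Sum>\<sigma> | \<sigma> permutes {1..Suc m}. f \<sigma>) = (\<Sum>\<sigma> | \<sigma> permutes {1..Suc m}. f (inv \<sigma>))"
    by (rule sum_permutations_inverse)
  also have "\<dots> = (\<Sum>b\<in>{1..Suc m}. \<Sum>q | q permutes {1..m}. f (inv (transpose (Suc m) b \<circ> q)))"
    unfolding ins by (rule sum_over_permutations_insert) auto
  also have "\<dots> = (\<Sum>b\<in>{1..Suc m}. \<Sum>q | q permutes {1..m}. f (inv q \<circ> transpose (Suc m) b))"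
    by (intro sum.cong refl) (auto simp: o_inv_distrib permutes_bij)
  also have "\<dots> = (\<Sum>b\<in>{1..Suc m}. \<Sum>q | q permutes {1..m}. f (q \<circ> transpose (Suc m) b))"
    by (intro sum.cong refl sum_permutations_inverse[symmetric])
  finally show ?thesis .
qed

text \<open>The form is alternating under the permutations \<open>q\<close> of \<open>{1..N - 1}\<close>, so the sum over the
  permutations \<open>q \<circ> transpose N b\<close> of \<open>{1..N}\<close> is \<open>(N - 1)!\<close> times the sum over \<open>b\<close>.  The function
  \<open>lower n\<close> specialises the variable \<open>n + 1\<close>, if present, to the repeated variable \<open>0\<close>.\<close>

definition lower :: "nat \<Rightarrow> nat \<Rightarrow> nat" where
  "lower n i = (if i \<le> n \<or> 7 \<le> i then i else 0)"

text \<open>For \<open>b = N\<close> the transposition is the identity, hence the exception to the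
  minus sign.\<close>

definition swap_terms :: "nat \<Rightarrow> nat \<Rightarrow> (int \<times> nat list) list \<Rightarrow> nat \<Rightarrow> (int \<times> nat list) list" where
  "swap_terms n N L b = map (\<lambda>(k, w). ((if b = N then k else - k), map (lower n \<circ> transpose N b) w)) L"

definition detecting_terms :: "nat \<Rightarrow> nat \<Rightarrow> (int \<times> nat list) list \<Rightarrow> (int \<times> nat list) list" where
  "detecting_terms n N L = concat (map (swap_terms n N L) [1..<Suc N])"

definition table_value :: "(int \<times> nat list) list \<Rightarrow> nat list \<Rightarrow> int" where
  "table_value T u = (\<Sum>(c, e)\<leftarrow>T. if u = e then c else 0)"

definition detects :: "nat \<Rightarrow> (int \<times> nat list) list \<Rightarrow> (int \<times> nat list) list \<Rightarrow> bool" where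
  "detects n T L \<longleftrightarrow> list_all (\<lambda>(k, w). labels_ok n w) L \<and>
    list_all (\<lambda>(k, w). filter is_label w = [1..<Suc n]) (map sort_term L) \<and>
    (\<Sum>(k, w)\<leftarrow>map sort_term L. k * table_value T w) \<noteq> 0"

lemma detects_imp:
  assumes n: "n \<le> 6" and T: "list_all (\<lambda>(c, e). filter is_label e = [1..<Suc n]) T"
    and L: "detects n T L"
  shows "rat.combination (\<lambda>w. form n T (monomial w)) L \<noteq> 0"
proof -
  have val: "rat.combination (\<lambda>e. of_bool (u = e)) T = of_int (table_value T u)" for u
    unfolding table_value_def by (induction T) auto
  have "rat.combination (\<lambda>w. form n T (monomial w)) L =
      rat.combination (\<lambda>w. form n T (monomial w)) (map sort_term L)"
    by (rule rat.combination_sort_term[OF antisymmetric_form_monomial n]) (use L in \<open>simp add: detects_def\<close>)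
  also have "\<dots> = rat.combination (\<lambda>w. of_int (table_value T w)) (map sort_term L)"
  proof (intro rat.combination_cong ballI, clarify)
    fix k w assume "(k, w) \<in> set (map sort_term L)"
    then have "filter is_label w = [1..<Suc n]"
      using L by (auto simp: detects_def list_all_iff)
    then show "form n T (monomial w) = of_int (table_value T w)"
      using form_monomial_sorted[OF n _ T] val by simp
  qed
  also have "\<dots> = of_int (\<Sum>(k, w)\<leftarrow>map sort_term L. k * table_value T w)"
    by (induction L) (auto split: prod.splits)
  also have "\<dots> \<noteq> 0"
    using L unfolding detects_def of_int_eq_0_iff by blast
  finally show ?thesis .
qed

text \<open>The tetrad part vanishes, so the value is a multiple of the empty word, with coefficient
  \<open>fact m\<close> times the number that \<open>detects\<close> requires to be nonzero.\<close>

lemma eval_alternating_sum_neq_0: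
  assumes tetrad: "satisfied_by_tetrad TYPE(word_algebra) (alternating_sum N ts)"
    and N: "N = Suc m" "m \<le> n" "N \<le> 6" and n: "n \<le> 6"
    and T: "list_all (\<lambda>(c, e). filter is_label e = [1..<Suc n]) T"
    and ts: "list_all (\<lambda>(k, m). is_Quad m) ts"
    and L: "detects n T (detecting_terms n N (expand separated_words ts))"
  shows "eval_identity word_scale (twisted_quad n T) (\<lambda>i. letter (lower n i)) (alternating_sum N ts) \<noteq> 0"
proof -
  define v where "v = (\<lambda>i. letter (lower n i))"
  have proj_v: "proj \<circ> v = v"
    by (rule ext) (simp add: v_def proj_graded graded_def)
  define D where "D \<sigma> = rat.combination (\<lambda>w. form n T (monomial (map (lower n \<circ> \<sigma>) w))) (expand separated_words ts)" for \<sigma>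
  have "word.combination (eval_monomial (twisted_quad n T) (v \<circ> \<sigma>)) ts =
      word.combination (eval_monomial tetrad (v \<circ> \<sigma>)) ts + Poly_Mapping.single 0 (D \<sigma>)"
    if \<sigma>: "\<sigma> permutes {1..N}" for \<sigma>
  proof -
    have "(v \<circ> \<sigma>) i = letter i" if "i \<in> {7, 8, 9}" for i
      using \<sigma> N(3) that by (auto simp: permutes_def v_def lower_def)
    moreover have "list_all (\<lambda>(k, m). \<exists>p q r s. m = \<langle>p, q, r, s\<rangle>) ts"
      using ts by (simp add: is_Quad_iff)
    moreover have "prod_list (map (v \<circ> \<sigma>) w) = monomial (map (lower n \<circ> \<sigma>) w)" for w
      using prod_list_monomial[of "\<lambda>i. [lower n (\<sigma> i)]" w]
      by (simp add: v_def o_def concat_map_singleton)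
    moreover have "proj \<circ> (v \<circ> \<sigma>) = v \<circ> \<sigma>"
      using proj_v by (simp only: comp_assoc[symmetric])
    ultimately show ?thesis
      using combination_twisted_quad[of "v \<circ> \<sigma>" ts n T] by (simp only: D_def)
  qed
  then have "eval_identity word_scale (twisted_quad n T) v (alternating_sum N ts) =
      (\<Sum>\<sigma> | \<sigma> permutes {1..N}. word_scale (of_int (sign \<sigma>))
        (word.combination (eval_monomial tetrad (v \<circ> \<sigma>)) ts + Poly_Mapping.single 0 (D \<sigma>)))"
    unfolding word.eval_identity_alternating_sum by (intro sum.cong refl) simp
  also have "\<dots> = eval_identity word_scale tetrad v (alternating_sum N ts) +
      (\<Sum>\<sigma> | \<sigma> permutes {1..N}. word_scale (of_int (sign \<sigma>)) (Poly_Mapping.single 0 (D \<sigma>)))"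
    unfolding word.eval_identity_alternating_sum word.scale_right_distrib sum.distrib ..
  also have "eval_identity word_scale tetrad v (alternating_sum N ts) = 0"
    using tetrad word.associative_algebra_axioms unfolding satisfied_by_tetrad_def by blast
  also have "0 + (\<Sum>\<sigma> | \<sigma> permutes {1..N}. word_scale (of_int (sign \<sigma>)) (Poly_Mapping.single 0 (D \<sigma>))) =
      Poly_Mapping.single 0 (\<Sum>\<sigma> | \<sigma> permutes {1..N}. of_int (sign \<sigma>) * D \<sigma>)"
  proof -
    have "(\<Sum>x\<in>A. Poly_Mapping.single 0 (f x)) = Poly_Mapping.single 0 (\<Sum>x\<in>A. f x)"
      for A and f :: "(nat \<Rightarrow> nat) \<Rightarrow> rat"
      by (induction A rule: infinite_finite_induct) (auto simp: single_add)
    then show ?thesis by (simp flip: single_zero_scale)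
  qed
  also have "(\<Sum>\<sigma> | \<sigma> permutes {1..N}. of_int (sign \<sigma>) * D \<sigma>) =
      fact m * (\<Sum>b\<in>{1..N}. of_int (sign (transpose N b)) * D (transpose N b))"
  proof -
    have "of_int (sign (q \<circ> transpose N b)) * D (q \<circ> transpose N b) =
        of_int (sign (transpose N b)) * D (transpose N b)"
      if q: "q permutes {1..m}" for q b
    proof -
      have q': "q permutes {1..n}"
        using N(2) by (intro permutes_subset[OF q]) auto
      \<comment> \<open>\<open>lower n\<close> fixes the labels up to \<open>m \<le> n\<close>, the
        only ones that \<open>q\<close> can move; any other letter goes to itself or to 0, and
        \<open>q\<close> fixes both.\<close>
      have "lower n \<circ> (q \<circ> transpose N b) = q \<circ> (lower n \<circ> transpose N b)"
      proof
        fix i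
        have "lower n (q j) = q (lower n j)" for j
        proof (cases "j \<in> {1..m}")
          case True
          then have "q j \<in> {1..m}" using permutes_in_image[OF q] by blast
          with True N(2) show ?thesis by (simp add: lower_def)
        next
          case False
          then have "q j = j" "q 0 = 0" using q by (auto simp: permutes_def)
          then show ?thesis by (simp add: lower_def)
        qed
        then show "(lower n \<circ> (q \<circ> transpose N b)) i = (q \<circ> (lower n \<circ> transpose N b)) i" by simp
      qed
      then have "form n T (monomial (map (lower n \<circ> (q \<circ> transpose N b)) w)) =
          of_int (sign q) * form n T (monomial (map (lower n \<circ> transpose N b) w))" for w
        using form_monomial_permute[OF q', of T "map (lower n \<circ> transpose N b) w"]
        by (simp only: map_map)
      then have "D (q \<circ> transpose N b) = of_int (sign q) * D (transpose N b)"
        unfolding D_def by (simp only: rat.combination_scale)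
      moreover have "sign (q \<circ> transpose N b) = sign q * sign (transpose N b)"
        using q by (intro sign_compose permutation_swap_id) (auto intro: permutation_permutes[THEN iffD2])
      \<comment> \<open>One sign of \<open>q\<close> comes from the alternating sum, the other from
        the form.\<close>
      moreover have "of_int (sign q) * of_int (sign q) = (1 :: rat)"
        by (simp flip: of_int_mult)
      ultimately show ?thesis by (simp add: mult.assoc[symmetric] mult.commute)
    qed
    then show ?thesis
      unfolding N(1) sum_permutations_Suc
      by (simp add: card_permutations[of _ m] sum_distrib_left distrib_left)
  qed
  also have "(\<Sum>b\<in>{1..N}. of_int (sign (transpose N b)) * D (transpose N b)) =
      rat.combination (\<lambda>w. form n T (monomial w)) (detecting_terms n N (expand separated_words ts))"
  proof -
    have "of_int (sign (transpose N b)) * D (transpose N b) =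
        rat.combination (\<lambda>w. form n T (monomial w)) (swap_terms n N (expand separated_words ts) b)" for b
      unfolding D_def swap_terms_def rat.scale_sum_list map_map
      by (intro arg_cong[where f = sum_list] map_cong refl) (auto simp: sign_swap_id)
    then show ?thesis
      unfolding detecting_terms_def sum_list_concat
      by (simp add: o_def interv_sum_list_conv_sum_set_nat atLeastLessThanSuc_atLeastAtMost del: upt_Suc)
  qed
  finally show ?thesis
    using detects_imp[OF n T L] unfolding v_def
    by (simp add: poly_mapping_eq_iff fun_eq_iff lookup_single when_def)
qed

section \<open>The two linear forms\<close>

text \<open>Between separators, the blocks have lengths 1, 1, 7, 1, or 1, 4, 4, 1 in the last entry.
  In the identities the nested argument of the outermost bracket has length 7; this form sees it in
  second place, through the reversed summand, but not in first place. So (2) and (5), where it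
  always stands first, call for another form.\<close>

definition table4 :: "(int \<times> nat list) list" where
  "table4 = [
    (1, [0, 7, 1, 8, 0, 2, 0, 0, 3, 0, 4, 9, 0]),
    (-1, [0, 7, 1, 8, 0, 2, 0, 3, 0, 0, 4, 9, 0]),
    (1, [0, 7, 1, 8, 2, 0, 3, 0, 4, 0, 0, 9, 0]),
    (-1, [0, 7, 1, 8, 2, 0, 3, 0, 0, 4, 0, 9, 0]),
    (1, [0, 7, 1, 8, 2, 0, 0, 3, 0, 4, 0, 9, 0]),
    (-1, [0, 7, 1, 8, 0, 0, 2, 0, 3, 0, 4, 9, 0]),
    (1, [0, 7, 0, 8, 1, 0, 2, 0, 3, 0, 4, 9, 0]),
    (-1, [0, 7, 0, 1, 0, 2, 8, 3, 0, 4, 0, 9, 0])]"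

text \<open>The entries with block lengths 1, 1, 1, 7 detect (2) and (5), by the reversed summand of
  a bracket nested in first place. Those with lengths 1, 1, 7, 1 take part in the cancellations that
  the axioms demand.\<close>

definition table5 :: "(int \<times> nat list) list" where
  "table5 = [
    (-1, [1, 7, 0, 8, 0, 2, 0, 0, 3, 0, 4, 9, 5]),
    (1, [1, 7, 0, 8, 0, 0, 2, 0, 3, 0, 4, 9, 5]),
    (1, [1, 7, 0, 8, 2, 0, 3, 0, 0, 4, 0, 9, 5]),
    (-1, [1, 7, 0, 8, 2, 0, 3, 0, 4, 0, 0, 9, 5]),
    (1, [1, 7, 0, 8, 2, 0, 3, 0, 4, 0, 5, 9, 0]),
    (-1, [1, 7, 0, 8, 0, 9, 2, 0, 3, 0, 4, 0, 5]),
    (1, [0, 7, 1, 8, 0, 9, 2, 0, 3, 0, 4, 0, 5]),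
    (1, [1, 7, 0, 8, 2, 9, 0, 3, 0, 0, 4, 0, 5]),
    (-1, [1, 7, 0, 8, 2, 9, 0, 3, 0, 4, 0, 0, 5]),
    (1, [1, 7, 0, 8, 2, 9, 3, 0, 0, 4, 0, 5, 0]),
    (-1, [1, 7, 0, 8, 2, 9, 3, 0, 4, 0, 0, 5, 0])]"

section \<open>Verification of the two systems and failure of the five identities\<close>

lemma tetrad_check_identities:
  "tetrad_check identity_i_terms" "tetrad_check identity_ii_terms" "tetrad_check identity_iii_terms"
  by code_simp+

lemma form_check_table4:
  "form_check 4 table4 (expand separated_words identity_i_terms)"
  "form_check 4 table4 (expand separated_words identity_ii_terms)"
  "form_check 4 table4 (expand separated_words identity_iii_terms)"
  by code_simp+

lemma form_check_table5:
  "form_check 5 table5 (expand separated_words identity_i_terms)"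
  "form_check 5 table5 (expand separated_words identity_ii_terms)"
  "form_check 5 table5 (expand separated_words identity_iii_terms)"
  by code_simp+

lemma JQS_table4: "jordan_quadruple_system word_scale (twisted_quad 4 table4)"
  by (rule jordan_quadruple_system_twisted_quad[OF _ _ tetrad_check_identities form_check_table4]) (simp_all add: table4_def)

lemma JQS_table5: "jordan_quadruple_system word_scale (twisted_quad 5 table5)"
  by (rule jordan_quadruple_system_twisted_quad[OF _ _ tetrad_check_identities form_check_table5]) (simp_all add: table5_def)

text \<open>The system lives on \<open>word_algebra\<close>, whereas \<open>JQS_consequence\<close>
  speaks of \<open>nat \<Rightarrow>\<^sub>0 rat\<close>; \<open>JQS_consequenceD\<close> bridges
  the two.\<close>

lemma not_JQS_consequence:
  assumes "jordan_quadruple_system word_scale (twisted_quad n T)"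
    and "satisfied_by_tetrad TYPE(word_algebra) (alternating_sum N ts)"
    and "N = Suc m" "m \<le> n" "N \<le> 6" "n \<le> 6"
    and "list_all (\<lambda>(c, e). filter is_label e = [1..<Suc n]) T"
    and "list_all (\<lambda>(k, m). is_Quad m) ts"
    and "detects n T (detecting_terms n N (expand separated_words ts))"
  shows "\<not> JQS_consequence (alternating_sum N ts)"
  using JQS_consequenceD[OF _ assms(1)] eval_alternating_sum_neq_0[OF assms(2-)] by blast

lemma not_JQS_consequence_identity1: "\<not> JQS_consequence identity1"
  unfolding identity1_def Let_def
  by (rule not_JQS_consequence[OF JQS_table4 satisfied_by_tetrad_identity1[unfolded identity1_def Let_def],
        where m = 3]; code_simp)

lemma not_JQS_consequence_identity2: "\<not> JQS_consequence identity2"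
  unfolding identity2_def Let_def
  by (rule not_JQS_consequence[OF JQS_table5 satisfied_by_tetrad_identity2[unfolded identity2_def Let_def],
        where m = 4]; code_simp)

lemma not_JQS_consequence_identity3: "\<not> JQS_consequence identity3"
  unfolding identity3_def Let_def
  by (rule not_JQS_consequence[OF JQS_table4 satisfied_by_tetrad_identity3[unfolded identity3_def Let_def],
        where m = 4]; code_simp)

lemma not_JQS_consequence_identity4: "\<not> JQS_consequence identity4"
  unfolding identity4_def Let_def
  by (rule not_JQS_consequence[OF JQS_table4 satisfied_by_tetrad_identity4[unfolded identity4_def Let_def],
        where m = 4]; code_simp)

lemma not_JQS_consequence_identity5: "\<not> JQS_consequence identity5"
  unfolding identity5_def Let_def
  by (rule not_JQS_consequence[OF JQS_table5 satisfied_by_tetrad_identity5[unfolded identity5_def Let_def],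
        where m = 5]; code_simp)

theorem theorem4p9:
  shows "\<forall>I \<in> {identity1, identity2, identity3, identity4, identity5}.
           satisfied_by_tetrad TYPE('a::ring) I \<and> \<not> JQS_consequence I"
  using satisfied_by_tetrad_identity1 satisfied_by_tetrad_identity2 satisfied_by_tetrad_identity3
    satisfied_by_tetrad_identity4 satisfied_by_tetrad_identity5
    not_JQS_consequence_identity1 not_JQS_consequence_identity2 not_JQS_consequence_identity3
    not_JQS_consequence_identity4 not_JQS_consequence_identity5
  by blast

end
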